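(* The property $\mathcal{D}^{\rm Ucyc}=\bigcup_{x^*\in\{0,1\}^n}\{\mathcal{D}^{\rm Ucyc}(x^* )\}$ can be tested in the DoHO model using $\widetilde{O}(n^{2/3}/\epsilon^3)$ queries.
   Context: For $x^*\in\{0,1\}^n$, $\mathcal{D}^{\rm Ucyc}(x^* )$ denotes the distribution of $x^*_{(1+J)_n}x^*_{(2+J)_n}\cdots x^*_{(n+J)_n}$ where $J$ is uniform on $\{0,1,\dots,n-1\}$ and $(i+j)_n$ is $i+j$ if $i+j\le n$ and $i+j-n$ otherwise (the uniform distribution over cyclic shifts of $x^*$). For $x,y\in\{0,1\}^n$ let $\Delta_H(x,y)=\frac1n|\{i:x_i\neq y_i\}|$. The distance between distributions $P,Q$ over $\{0,1\}^n$ is $\min\sum_{x,y}w_{x,y}\Delta_H(x,y)$ over nonnegative $w_{x,y}$ with $\sum_y w_{x,y}=P(x)$, $\sum_x w_{x,y}=Q(y)$; $\epsilon$-far from a set means distance greater than $\epsilon$ to every member. A tester in the DoHO model for a set $\mathcal{E}$ of distributions over $\{0,1\}^n$ gets $n,\epsilon$ and oracle access to independent samples of an unknown distribution $P$, may query individual bits of samples, and must accept with probability at least $2/3$ if $P\in\mathcal{E}$ and reject with probability at least $2/3$ if $P$ is $\epsilon$-far from $\mathcal{E}$; its query complexity is the total number of bit queries. *)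

theory Defs
  imports "HOL-Probability.Probability"
begin

text \<open>
  Strings over \<open>{0,1}\<close> are boolean lists, so positions run over \<open>{0..<n}\<close> instead of
  \<open>{1..n}\<close>; a distribution over \<open>{0,1}\<close>-strings of length \<open>n\<close> is a \<^typ>\<open>bool list pmf\<close>
  whose support lies in \<open>cube n\<close>.
\<close>

definition cube :: "nat \<Rightarrow> bool list set" where
  "cube n = {x. length x = n}"

definition rel_hamming :: "nat \<Rightarrow> bool list \<Rightarrow> bool list \<Rightarrow> real" where
  "rel_hamming n x y = real (card {i. i < n \<and> x ! i \<noteq> y ! i}) / real n"

definition transport_plans ::
  "nat \<Rightarrow> bool list pmf \<Rightarrow> bool list pmf \<Rightarrow> (bool list \<Rightarrow> bool list \<Rightarrow> real) set" where
  "transport_plans n P Q =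
     {w. (\<forall>x\<in>cube n. \<forall>y\<in>cube n. 0 \<le> w x y) \<and>
         (\<forall>x\<in>cube n. (\<Sum>y\<in>cube n. w x y) = pmf P x) \<and>
         (\<forall>y\<in>cube n. (\<Sum>x\<in>cube n. w x y) = pmf Q y)}"

text \<open>
  For \<open>P\<close> and \<open>Q\<close> supported on \<open>cube n\<close> the infimum is over a nonempty set and is attained
  (a linear functional on a compact polytope), so it is the minimum.
\<close>

definition dist_distance :: "nat \<Rightarrow> bool list pmf \<Rightarrow> bool list pmf \<Rightarrow> real" where
  "dist_distance n P Q =
     (INF w \<in> transport_plans n P Q. \<Sum>x\<in>cube n. \<Sum>y\<in>cube n. w x y * rel_hamming n x y)"

definition far_from :: "nat \<Rightarrow> real \<Rightarrow> bool list pmf \<Rightarrow> bool list pmf set \<Rightarrow> bool" where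
  "far_from n \<epsilon> P \<E> \<longleftrightarrow> (\<forall>Q\<in>\<E>. dist_distance n P Q > \<epsilon>)"

text \<open>
  A deterministic adaptive algorithm is a decision tree: \<open>Query i j t0 t1\<close> reads the \<open>j\<close>-th bit
  of the \<open>i\<close>-th sample and continues as \<open>t0\<close> or \<open>t1\<close> when that bit is 0 or 1, respectively.
\<close>

datatype dtree = Verdict bool | Query nat nat dtree dtree

primrec run :: "dtree \<Rightarrow> (nat \<Rightarrow> bool list) \<Rightarrow> bool" where
  "run (Verdict b) X = b"
| "run (Query i j t0 t1) X = (if X i ! j then run t1 X else run t0 X)"

primrec num_queries :: "dtree \<Rightarrow> nat" where
  "num_queries (Verdict b) = 0"
| "num_queries (Query i j t0 t1) = Suc (max (num_queries t0) (num_queries t1))"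

primrec well_formed :: "nat \<Rightarrow> nat \<Rightarrow> dtree \<Rightarrow> bool" where
  "well_formed s n (Verdict b) \<longleftrightarrow> True"
| "well_formed s n (Query i j t0 t1) \<longleftrightarrow>
     i < s \<and> j < n \<and> well_formed s n t0 \<and> well_formed s n t1"

text \<open>
  A randomized algorithm is a pair \<open>(s, T)\<close> of a number \<open>s\<close> of samples and a distribution \<open>T\<close>
  (the internal coins) over decision trees. Below, the \<open>s\<close> samples are independent of each other
  and of the coins.
\<close>

type_synonym algorithm = "nat \<times> dtree pmf"

definition outcome :: "algorithm \<Rightarrow> bool list pmf \<Rightarrow> bool pmf" where
  "outcome A P =
     bind_pmf (snd A) (\<lambda>t. map_pmf (run t) (Pi_pmf {..<fst A} [] (\<lambda>_. P)))"

definition is_tester ::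
  "(nat \<Rightarrow> bool list pmf set) \<Rightarrow> nat \<Rightarrow> real \<Rightarrow> algorithm \<Rightarrow> bool" where
  "is_tester \<E> n \<epsilon> A \<longleftrightarrow>
     (\<forall>t\<in>set_pmf (snd A). well_formed (fst A) n t) \<and>
     (\<forall>P. set_pmf P \<subseteq> cube n \<longrightarrow>
        (P \<in> \<E> n \<longrightarrow> pmf (outcome A P) True \<ge> 2/3) \<and>
        (far_from n \<epsilon> P (\<E> n) \<longrightarrow> pmf (outcome A P) False \<ge> 2/3))"

text \<open>Worst case over the coins and over all possible answers.\<close>

definition query_complexity_le :: "algorithm \<Rightarrow> nat \<Rightarrow> bool" where
  "query_complexity_le A q \<longleftrightarrow> (\<forall>t\<in>set_pmf (snd A). num_queries t \<le> q)"

definition DoHO_testable ::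
  "(nat \<Rightarrow> bool list pmf set) \<Rightarrow> (nat \<Rightarrow> real \<Rightarrow> nat) \<Rightarrow> bool" where
  "DoHO_testable \<E> q \<longleftrightarrow>
     (\<exists>A :: nat \<Rightarrow> real \<Rightarrow> algorithm.
        \<forall>n \<epsilon>. 1 \<le> n \<and> 0 < \<epsilon> \<longrightarrow>
          is_tester \<E> n \<epsilon> (A n \<epsilon>) \<and> query_complexity_le (A n \<epsilon>) (q n \<epsilon>))"

text \<open>
  \<open>O\<close>-tilde of \<open>f\<close> is \<open>f\<close> times a polylogarithm of \<open>f\<close>, with constants uniform in \<open>n\<close> and
  \<open>\<epsilon>\<close>. The summand 2 only keeps the logarithm positive.
\<close>

definition soft_O :: "(nat \<Rightarrow> real \<Rightarrow> nat) \<Rightarrow> (nat \<Rightarrow> real \<Rightarrow> real) \<Rightarrow> bool" where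
  "soft_O q f \<longleftrightarrow>
     (\<exists>(C::real) (k::nat). \<forall>n \<epsilon>. 1 \<le> n \<and> 0 < \<epsilon> \<longrightarrow>
        real (q n \<epsilon>) \<le> C * f n \<epsilon> * ln (2 + f n \<epsilon>) ^ k)"

text \<open>\<^term>\<open>rotate J x\<close> moves the first \<open>J\<close> bits of \<open>x\<close> to its end.\<close>

definition Ucyc_dist :: "bool list \<Rightarrow> bool list pmf" where
  "Ucyc_dist x = map_pmf (\<lambda>J. rotate J x) (pmf_of_set {0..<length x})"

definition Ucyc :: "nat \<Rightarrow> bool list pmf set" where
  "Ucyc n = (\<Union>x\<in>cube n. {Ucyc_dist x})"

end

theory Submission
  imports Defs
begin

text \<open>
  If the first sample \<open>x0\<close> comes from a distribution in the property, then that distribution is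
  \<open>Ucyc_dist x0\<close>, so it suffices to test closeness of \<open>P\<close> to this distribution \<open>Q\<close>, from which
  one can sample at will by querying \<open>x0\<close> at randomly shifted positions. Projecting all strings to
  \<open>O(log (n/\<epsilon>) / \<epsilon>)\<close> common random positions makes false matches with the at most \<open>n\<close> shifts of
  \<open>x0\<close> unlikely; hence a \<open>P\<close> that is \<open>\<epsilon>\<close>-far from \<open>Q\<close> still has projected statistical distance at
  least \<open>\<epsilon>/4\<close> from \<open>Q\<close>. That distance is detected by comparing self-collisions with cross
  collisions, after \<open>Q\<close> has been flattened: about \<open>n\<^sup>2\<^sup>/\<^sup>3\<close> samples of \<open>Q\<close> are drawn, and a
  collision at a point hit \<open>a\<close> times gets weight \<open>1/(1 + a)\<close>. This brings the weighted
  \<open>L\<^sub>2\<close> norm of \<open>Q\<close> down so far that \<open>O(n\<^sup>2\<^sup>/\<^sup>3 / \<epsilon>\<^sup>2)\<close> further samples suffice by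
  Chebyshev's inequality.
\<close>

section \<open>Expectations over independent samples\<close>

abbreviation expect :: "'a pmf \<Rightarrow> ('a \<Rightarrow> real) \<Rightarrow> real" where
  "expect p f \<equiv> measure_pmf.expectation p f"

lemma expect_sum_superset:
  assumes "finite A" "set_pmf p \<subseteq> A"
  shows "expect p f = (\<Sum>a\<in>A. pmf p a * f a)"
  using assms by (subst integral_measure_pmf_real[of A]) (auto simp: mult.commute)

lemma expect_bind:
  assumes "finite (set_pmf p)" "\<And>x. x \<in> set_pmf p \<Longrightarrow> finite (set_pmf (f x))"
  shows "expect (p \<bind> f) h = expect p (\<lambda>x. expect (f x) h)"
  using assms by (subst pmf_expectation_bind[of "set_pmf p"])
    (simp_all add: expect_sum_superset[of "set_pmf p"])

lemma expect_add:
  assumes "finite (set_pmf p)"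
  shows "expect p (\<lambda>x. f x + g x) = expect p f + expect p g"
  by (rule Bochner_Integration.integral_add)
    (auto intro!: integrable_measure_pmf_finite assms)

lemma expect_diff:
  assumes "finite (set_pmf p)"
  shows "expect p (\<lambda>x. f x - g x) = expect p f - expect p g"
  by (rule Bochner_Integration.integral_diff)
    (auto intro!: integrable_measure_pmf_finite assms)

lemma expect_sum:
  assumes "finite (set_pmf p)"
  shows "expect p (\<lambda>x. \<Sum>i\<in>I. f i x) = (\<Sum>i\<in>I. expect p (f i))"
  by (rule Bochner_Integration.integral_sum)
    (auto intro!: integrable_measure_pmf_finite assms)

lemma expect_mono:
  assumes "finite (set_pmf p)" "\<And>x. x \<in> set_pmf p \<Longrightarrow> f x \<le> g x"
  shows "expect p f \<le> expect p g"
  by (rule integral_mono_AE)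
    (auto intro!: integrable_measure_pmf_finite assms simp: AE_measure_pmf_iff)

lemma expect_cong:
  assumes "\<And>x. x \<in> set_pmf p \<Longrightarrow> f x = g x"
  shows "expect p f = expect p g"
  by (rule integral_cong_AE) (auto simp: AE_measure_pmf_iff assms)

lemma expect_swap:
  assumes "finite (set_pmf p)" "finite (set_pmf q)"
  shows "expect p (\<lambda>x. expect q (h x)) = expect q (\<lambda>y. expect p (\<lambda>x. h x y))"
  unfolding expect_sum_superset[OF assms(1) order_refl] expect_sum_superset[OF assms(2) order_refl]
    sum_distrib_left
  by (subst sum.swap) (simp add: mult.left_commute)

lemma expect_sum_list:
  assumes "finite (set_pmf p)"
  shows "expect p (\<lambda>x. \<Sum>i\<leftarrow>is. f i x) = (\<Sum>i\<leftarrow>is. expect p (f i))"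
  by (induction "is") (simp_all add: expect_add assms)

lemma expect_pair:
  assumes "finite (set_pmf p)" "finite (set_pmf q)"
  shows "expect (pair_pmf p q) h = expect p (\<lambda>x. expect q (\<lambda>y. h (x, y)))"
  unfolding pair_pmf_def by (subst expect_bind; (subst expect_bind)?) (auto simp: assms)

lemma markov_pmf:
  assumes "finite (set_pmf p)" "\<And>x. x \<in> set_pmf p \<Longrightarrow> 0 \<le> f x" "0 < c"
  shows "measure_pmf.prob p {x. c \<le> f x} \<le> expect p f / c"
proof -
  have "measure_pmf.prob p {x. c \<le> f x} = expect p (indicator {x. c \<le> f x})"
    by simp
  also have "\<dots> \<le> expect p (\<lambda>x. f x / c)"
    using assms by (intro expect_mono) (auto simp: indicator_def)
  finally show ?thesis by simp
qed

lemma finite_set_replicate_pmf [intro, simp]: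
  "finite (set_pmf p) \<Longrightarrow> finite (set_pmf (replicate_pmf n p))"
  unfolding set_replicate_pmf using finite_lists_length_eq[of "set_pmf p" n]
  by (auto simp: in_lists_conv_set subset_iff elim: rev_finite_subset)

lemma expect_replicate_Suc:
  assumes "finite (set_pmf p)"
  shows "expect (replicate_pmf (Suc n) p) h
    = expect p (\<lambda>x. expect (replicate_pmf n p) (\<lambda>xs. h (x # xs)))"
  using assms by (simp add: expect_bind)

lemma replicate_pmf_map:
  "replicate_pmf n (map_pmf f p) = map_pmf (map f) (replicate_pmf n p)"
  by (induction n) (simp_all add: map_pmf_def bind_assoc_pmf bind_return_pmf)

lemma replicate_pmf_pair:
  "replicate_pmf n (pair_pmf p q)
     = bind_pmf (replicate_pmf n p) (\<lambda>xs. map_pmf (zip xs) (replicate_pmf n q))"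
proof (induction n)
  case 0
  then show ?case by (simp add: bind_return_pmf)
next
  case (Suc n)
  show ?case
    apply (simp add: Suc)
    apply (simp add: pair_pmf_def map_pmf_def bind_assoc_pmf bind_return_pmf)
    apply (subst bind_commute_pmf[of q])
    apply (rule refl)
    done
qed

text \<open>Variance plus squared bias of an i.i.d. sum. The centre \<open>c\<close> is arbitrary
  because peeling off the first sample \<open>x\<close> turns it into
  \<open>c - f x\<close>.\<close>

lemma expect_iid_sum_square:
  assumes fin: "finite (set_pmf p)"
  shows "expect (replicate_pmf s p) (\<lambda>zs. ((\<Sum>z\<leftarrow>zs. f z) - c)\<^sup>2)
    = real s * (expect p (\<lambda>z. (f z)\<^sup>2) - (expect p f)\<^sup>2) + (real s * expect p f - c)\<^sup>2"
proof (induction s arbitrary: c)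
  case 0
  then show ?case by simp
next
  case (Suc s)
  let ?e = "expect p f" and ?q = "expect p (\<lambda>z. (f z)\<^sup>2)"
  let ?d = "real s * ?e - c"
  have "expect (replicate_pmf (Suc s) p) (\<lambda>zs. ((\<Sum>z\<leftarrow>zs. f z) - c)\<^sup>2)
      = expect p (\<lambda>x. expect (replicate_pmf s p) (\<lambda>zs. ((\<Sum>z\<leftarrow>zs. f z) - (c - f x))\<^sup>2))"
    unfolding expect_replicate_Suc[OF fin] by (simp add: algebra_simps)
  also have "\<dots> = expect p (\<lambda>x. real s * (?q - ?e\<^sup>2) + (real s * ?e - (c - f x))\<^sup>2)"
    unfolding Suc ..
  also have "\<dots> = expect p (\<lambda>x. (real s * (?q - ?e\<^sup>2) + ?d\<^sup>2) + ((f x)\<^sup>2 + (2 * ?d) * f x))"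
    by (rule arg_cong[where f = "expect p"]) (auto simp: power2_eq_square algebra_simps)
  also have "\<dots> = (real s * (?q - ?e\<^sup>2) + ?d\<^sup>2) + (?q + (2 * ?d) * ?e)"
    by (simp add: expect_add fin)
  also have "\<dots> = real (Suc s) * (?q - ?e\<^sup>2) + (real (Suc s) * ?e - c)\<^sup>2"
    by (simp add: power2_eq_square algebra_simps)
  finally show ?case .
qed

lemma expect_iid_sum_square_le:
  assumes fin: "finite (set_pmf p)"
  shows "expect (replicate_pmf s p) (\<lambda>zs. ((\<Sum>z\<leftarrow>zs. f z) - c)\<^sup>2)
    \<le> real s * expect p (\<lambda>z. (f z)\<^sup>2) + (real s * expect p f - c)\<^sup>2"
  unfolding expect_iid_sum_square[OF fin] by (simp add: algebra_simps)

text \<open>The two batches are independent, so the bound for i.i.d. sums applies first to the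
  second batch with the first one fixed, and then to the first batch. Pairing across batches avoids
  pairs of a sample with itself.\<close>

lemma bipartite_u_statistic:
  fixes K :: "'a \<Rightarrow> 'a \<Rightarrow> real"
  assumes fin: "finite (set_pmf R)" and sym: "\<And>x y. K x y = K y x"
  defines "\<theta> \<equiv> expect R (\<lambda>x. expect R (K x))"
  shows "expect (replicate_pmf s R) (\<lambda>zs. expect (replicate_pmf s R)
      (\<lambda>zs'. ((\<Sum>a\<leftarrow>zs. \<Sum>b\<leftarrow>zs'. K a b) - (real s)\<^sup>2 * \<theta>)\<^sup>2))
    \<le> (real s)\<^sup>2 * expect R (\<lambda>x. expect R (\<lambda>y. (K x y)\<^sup>2))
       + 2 * real s ^ 3 * expect R (\<lambda>x. (expect R (K x))\<^sup>2)"
proof -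
  let ?D = "replicate_pmf s R"
  let ?k = "\<lambda>x. expect R (K x)"
  let ?M = "expect R (\<lambda>x. expect R (\<lambda>y. (K x y)\<^sup>2))" and ?L = "expect R (\<lambda>x. (?k x)\<^sup>2)"
  have fD: "finite (set_pmf ?D)" using fin by simp
  have swap: "(\<Sum>a\<leftarrow>zs. \<Sum>b\<leftarrow>zs'. K a b) = (\<Sum>b\<leftarrow>zs'. \<Sum>a\<leftarrow>zs. K a b)" for zs zs'
    by (induction zs) (simp_all add: sum_list_addf)
  have k: "expect R (\<lambda>x. K x y) = ?k y" for y
    by (subst sym) (rule refl)
  \<comment> \<open>Given the first batch, the statistic is an i.i.d. sum over the second one, with
    summands of mean \<open>sum of ?k a over zs\<close>. The \<open>- 0\<close> prepares the next
    use of the same bound, with centre \<open>0\<close>.\<close>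
  have inner: "expect ?D (\<lambda>zs'. ((\<Sum>a\<leftarrow>zs. \<Sum>b\<leftarrow>zs'. K a b) - (real s)\<^sup>2 * \<theta>)\<^sup>2)
      \<le> real s * expect R (\<lambda>b. ((\<Sum>a\<leftarrow>zs. K a b) - 0)\<^sup>2)
        + (real s)\<^sup>2 * ((\<Sum>a\<leftarrow>zs. ?k a) - real s * \<theta>)\<^sup>2" for zs
  proof -
    have "expect ?D (\<lambda>zs'. ((\<Sum>a\<leftarrow>zs. \<Sum>b\<leftarrow>zs'. K a b) - (real s)\<^sup>2 * \<theta>)\<^sup>2)
      \<le> real s * expect R (\<lambda>b. (\<Sum>a\<leftarrow>zs. K a b)\<^sup>2)
         + (real s * (\<Sum>a\<leftarrow>zs. ?k a) - (real s)\<^sup>2 * \<theta>)\<^sup>2"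
      unfolding swap expect_sum_list[OF fin, symmetric] by (rule expect_iid_sum_square_le[OF fin])
    also have "(real s * (\<Sum>a\<leftarrow>zs. ?k a) - (real s)\<^sup>2 * \<theta>)\<^sup>2
        = (real s)\<^sup>2 * ((\<Sum>a\<leftarrow>zs. ?k a) - real s * \<theta>)\<^sup>2"
      by (simp add: power2_eq_square algebra_simps)
    finally show ?thesis by simp
  qed
  have "expect ?D (\<lambda>zs. expect ?D (\<lambda>zs'. ((\<Sum>a\<leftarrow>zs. \<Sum>b\<leftarrow>zs'. K a b) - (real s)\<^sup>2 * \<theta>)\<^sup>2))
      \<le> expect ?D (\<lambda>zs. real s * expect R (\<lambda>b. ((\<Sum>a\<leftarrow>zs. K a b) - 0)\<^sup>2)
        + (real s)\<^sup>2 * ((\<Sum>a\<leftarrow>zs. ?k a) - real s * \<theta>)\<^sup>2)"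
    by (rule expect_mono[OF fD inner])
  also have "\<dots> = real s * expect R (\<lambda>b. expect ?D (\<lambda>zs. ((\<Sum>a\<leftarrow>zs. K a b) - 0)\<^sup>2))
      + (real s)\<^sup>2 * expect ?D (\<lambda>zs. ((\<Sum>a\<leftarrow>zs. ?k a) - real s * \<theta>)\<^sup>2)"
    by (simp add: expect_add fD expect_swap[OF fD fin])
  \<comment> \<open>Now over the first batch: for each fixed \<open>b\<close> around
    \<open>0\<close>, and for the remaining term around its true mean, where the bias
    vanishes.\<close>
  also have "\<dots> \<le> real s * expect R (\<lambda>b. real s * expect R (\<lambda>a. (K a b)\<^sup>2)
        + (real s * ?k b - 0)\<^sup>2)
      + (real s)\<^sup>2 * (real s * ?L + (real s * \<theta> - real s * \<theta>)\<^sup>2)"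
    unfolding k[symmetric]
    apply (intro add_mono mult_left_mono expect_mono fin expect_iid_sum_square_le)
      apply simp_all
    apply (rule order_trans[OF expect_iid_sum_square_le[OF fin]])
    apply (simp add: \<theta>_def k)
    done
  also have "\<dots> = real s * (real s * expect R (\<lambda>b. expect R (\<lambda>a. (K a b)\<^sup>2)) + (real s)\<^sup>2 * ?L)
      + (real s)\<^sup>2 * (real s * ?L)"
    by (simp add: expect_add fin power_mult_distrib)
  also have "expect R (\<lambda>b. expect R (\<lambda>a. (K a b)\<^sup>2)) = ?M"
    by (subst sym) (rule refl)
  finally show ?thesis
    by (simp add: power2_eq_square power3_eq_cube algebra_simps)
qed

section \<open>The weighted collision statistic\<close>

lemma expect_of_bool_eq:
  "expect p (\<lambda>x. of_bool (u = x)) = pmf p u"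
  "expect p (\<lambda>x. of_bool (x = u)) = pmf p u"
proof -
  have "(\<lambda>x. of_bool (u = x)) = (indicator {u} :: _ \<Rightarrow> real)"
       "(\<lambda>x. of_bool (x = u)) = (indicator {u} :: _ \<Rightarrow> real)"
    by (auto simp: indicator_def)
  then show "expect p (\<lambda>x. of_bool (u = x)) = pmf p u" "expect p (\<lambda>x. of_bool (x = u)) = pmf p u"
    by (simp_all add: measure_pmf_single)
qed

text \<open>
  With \<open>e u\<close> the unit vector at \<open>u\<close>, this is the \<open>w\<close>-weighted inner product of \<open>e x - e y\<close> and
  \<open>e x' - e y'\<close>.
\<close>

definition collision_kernel :: "('a \<Rightarrow> real) \<Rightarrow> 'a \<times> 'a \<Rightarrow> 'a \<times> 'a \<Rightarrow> real" where
  "collision_kernel w = (\<lambda>(x, y) (x', y').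
     w x * of_bool (x = x') - w x * of_bool (x = y')
     - w y * of_bool (y = x') + w y * of_bool (y = y'))"

definition collision_stat :: "('a \<Rightarrow> real) \<Rightarrow> ('a \<times> 'a) list \<Rightarrow> ('a \<times> 'a) list \<Rightarrow> real" where
  "collision_stat w zs zs' = (\<Sum>a\<leftarrow>zs. \<Sum>b\<leftarrow>zs'. collision_kernel w a b)"

lemma collision_kernel_sym: "collision_kernel w z z' = collision_kernel w z' z"
  by (auto simp: collision_kernel_def split: prod.splits)

section \<open>Moments and deviation of the collision statistic\<close>

locale collision =
  fixes p q :: "'a pmf" and w :: "'a \<Rightarrow> real" and \<Omega> :: "'a set"
  assumes fin: "finite \<Omega>" and supp: "set_pmf p \<subseteq> \<Omega>" "set_pmf q \<subseteq> \<Omega>"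
    and w0: "\<And>u. 0 \<le> w u" and w1: "\<And>u. w u \<le> 1"
begin

text \<open>\<open>D\<close> is the mean of the kernel, \<open>B\<close> governs its variance, and
  \<open>b\<close> is the part of \<open>B\<close> that flattening makes small.\<close>

definition D :: real where "D = (\<Sum>u\<in>\<Omega>. w u * (pmf p u - pmf q u)\<^sup>2)"
definition B :: real where "B = (\<Sum>u\<in>\<Omega>. w u * (pmf p u + pmf q u)\<^sup>2)"
definition b :: real where "b = (\<Sum>u\<in>\<Omega>. w u * (pmf q u)\<^sup>2)"

lemma finp: "finite (set_pmf p)" and finq: "finite (set_pmf q)"
  using fin supp finite_subset by blast+

lemma B_nonneg: "0 \<le> B"
  unfolding B_def by (auto intro!: sum_nonneg mult_nonneg_nonneg w0)

text \<open>Write \<open>p + q\<close> as \<open>2 q + (p - q)\<close> and use (x + y)^2 \<le> 2 x^2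
  + 2 y^2. The noise is thus controlled by the norm of \<open>q\<close> and the signal
  \<open>D\<close>, whatever the norm of \<open>p\<close> is.\<close>

lemma B_le: "B \<le> 8 * b + 2 * D"
  unfolding D_def B_def b_def sum_distrib_left sum.distrib[symmetric]
proof (rule sum_mono)
  fix u
  have "(pmf p u + pmf q u)\<^sup>2 \<le> 8 * (pmf q u)\<^sup>2 + 2 * (pmf p u - pmf q u)\<^sup>2"
    using zero_le_power2[of "pmf p u - 3 * pmf q u"]
    by (simp add: power2_eq_square algebra_simps)
  from mult_left_mono[OF this w0[of u]]
  show "w u * (pmf p u + pmf q u)\<^sup>2 \<le> 8 * (w u * (pmf q u)\<^sup>2) + 2 * (w u * (pmf p u - pmf q u)\<^sup>2)"
    by (simp add: algebra_simps)
qed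

lemma expect_p: "expect p f = (\<Sum>u\<in>\<Omega>. pmf p u * f u)"
  and expect_q: "expect q f = (\<Sum>u\<in>\<Omega>. pmf q u * f u)"
  using expect_sum_superset[OF fin] supp by auto

text \<open>In the weighted inner product \<open>e x' - e y'\<close> averages to
  \<open>p - q\<close>, so \<open>e x - e y\<close> gets paired with \<open>p - q\<close>. Averaging
  over \<open>(x, y)\<close> as well pairs \<open>p - q\<close> with itself, which is
  \<open>D\<close>.\<close>

lemma kernel_mean:
  "expect (pair_pmf p q) (collision_kernel w (x, y))
     = w x * (pmf p x - pmf q x) - w y * (pmf p y - pmf q y)"
proof -
  have "expect (pair_pmf p q) (collision_kernel w (x, y))
    = expect p (\<lambda>x'. expect q (\<lambda>y'. (w x * of_bool (x = x') - w y * of_bool (y = x'))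
      + (w y * of_bool (y = y') - w x * of_bool (x = y'))))"
    by (simp add: expect_pair finp finq collision_kernel_def algebra_simps)
  also have "\<dots> = expect p (\<lambda>x'. (w x * of_bool (x = x') - w y * of_bool (y = x'))
      + (w y * pmf q y - w x * pmf q x))"
    by (subst expect_add[OF finq], subst (2) expect_diff[OF finq]) (simp add: expect_of_bool_eq)
  also have "\<dots> = (w x * pmf p x - w y * pmf p y) + (w y * pmf q y - w x * pmf q x)"
    by (subst expect_add[OF finp], subst expect_diff[OF finp]) (simp add: expect_of_bool_eq)
  finally show ?thesis by (simp add: algebra_simps)
qed

lemma kernel_mean_mean:
  "expect (pair_pmf p q) (\<lambda>z. expect (pair_pmf p q) (collision_kernel w z)) = D"
proof -
  have "expect (pair_pmf p q) (\<lambda>z. expect (pair_pmf p q) (collision_kernel w z))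
    = expect p (\<lambda>x. expect q (\<lambda>y. w x * (pmf p x - pmf q x) - w y * (pmf p y - pmf q y)))"
    by (subst expect_pair[OF finp finq]) (simp add: kernel_mean)
  also have "\<dots> = expect p (\<lambda>x. w x * (pmf p x - pmf q x)) - expect q (\<lambda>y. w y * (pmf p y - pmf q y))"
    by (simp add: expect_diff finp finq)
  also have "\<dots> = D"
    unfolding expect_p expect_q D_def sum_subtractf[symmetric]
    by (intro sum.cong refl) (simp add: power2_eq_square algebra_simps)
  finally show ?thesis .
qed

text \<open>After (x - y)^2 \<le> 2 x^2 + 2 y^2 each point \<open>u\<close> contributes its share of
  \<open>D\<close> times twice the factor \<open>w u * (p u + q u)\<close>. That factor is at most
  \<open>sqrt B\<close>, since a maximum is at most an L2 norm and \<open>w \<le> 1\<close>.\<close>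

lemma kernel_mean_square:
  "expect (pair_pmf p q) (\<lambda>z. (expect (pair_pmf p q) (collision_kernel w z))\<^sup>2) \<le> 2 * sqrt B * D"
proof -
  define f where "f u = (w u * (pmf p u - pmf q u))\<^sup>2" for u
  have "expect (pair_pmf p q) (\<lambda>z. (expect (pair_pmf p q) (collision_kernel w z))\<^sup>2)
    = expect p (\<lambda>x. expect q (\<lambda>y. (w x * (pmf p x - pmf q x) - w y * (pmf p y - pmf q y))\<^sup>2))"
    by (subst expect_pair[OF finp finq]) (simp add: kernel_mean)
  also have "\<dots> \<le> expect p (\<lambda>x. expect q (\<lambda>y. 2 * f x + 2 * f y))"
  proof (intro expect_mono finp finq)
    fix x y
    show "(w x * (pmf p x - pmf q x) - w y * (pmf p y - pmf q y))\<^sup>2 \<le> 2 * f x + 2 * f y"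
      unfolding f_def using zero_le_power2[of "w x * (pmf p x - pmf q x) + w y * (pmf p y - pmf q y)"]
      by (simp add: power2_eq_square algebra_simps)
  qed
  also have "\<dots> = 2 * expect p f + 2 * expect q f"
    by (simp add: expect_add finp finq)
  also have "\<dots> = (\<Sum>u\<in>\<Omega>. 2 * (w u * (pmf p u + pmf q u)) * (w u * (pmf p u - pmf q u)\<^sup>2))"
    unfolding expect_p expect_q sum_distrib_left sum.distrib[symmetric] f_def
    by (intro sum.cong refl) (simp add: power2_eq_square algebra_simps)
  also have "\<dots> \<le> (\<Sum>u\<in>\<Omega>. 2 * sqrt B * (w u * (pmf p u - pmf q u)\<^sup>2))"
  proof (intro sum_mono mult_right_mono mult_left_mono mult_nonneg_nonneg w0)
    fix u assume u: "u \<in> \<Omega>"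
    have "(w u * (pmf p u + pmf q u))\<^sup>2 = w u * (w u * (pmf p u + pmf q u)\<^sup>2)"
      by (simp add: power2_eq_square algebra_simps)
    also have "\<dots> \<le> 1 * (w u * (pmf p u + pmf q u)\<^sup>2)"
      by (intro mult_right_mono w1 mult_nonneg_nonneg w0) simp
    also have "\<dots> \<le> B"
      unfolding B_def using u fin w0
      by (simp add: member_le_sum[of u \<Omega> "\<lambda>u. w u * (pmf p u + pmf q u)\<^sup>2"])
    finally show "w u * (pmf p u + pmf q u) \<le> sqrt B"
      by (rule real_le_rsqrt)
  qed auto
  also have "\<dots> = 2 * sqrt B * D"
    unfolding D_def by (simp add: sum_distrib_left)
  finally show ?thesis .
qed

text \<open>Squaring the sum of four collision terms costs a factor 4. Each squared indicator then
  integrates to a point probability, and one factor \<open>w u \<le> 1\<close> is dropped.\<close>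

lemma kernel_second_moment:
  "expect (pair_pmf p q) (\<lambda>z. expect (pair_pmf p q) (\<lambda>z'. (collision_kernel w z z')\<^sup>2)) \<le> 4 * B"
proof -
  let ?c = "\<lambda>x x'. (w x)\<^sup>2 * of_bool (x = x')"
  have "expect (pair_pmf p q) (\<lambda>z. expect (pair_pmf p q) (\<lambda>z'. (collision_kernel w z z')\<^sup>2))
    = expect p (\<lambda>x. expect q (\<lambda>y. expect p (\<lambda>x'. expect q (\<lambda>y'.
        (collision_kernel w (x, y) (x', y'))\<^sup>2))))"
    by (simp add: expect_pair[OF finp finq])
  also have "\<dots> \<le> expect p (\<lambda>x. expect q (\<lambda>y. expect p (\<lambda>x'. expect q (\<lambda>y'.
        4 * ((?c x x' + ?c y x') + (?c x y' + ?c y y'))))))"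
  proof (intro expect_mono finp finq)
    fix x y x' y'
    \<comment> \<open>Lagrange's identity: the two sides differ by the sum of the six squares
      supplied.\<close>
    have *: "(a - b - c + d)\<^sup>2 \<le> 4 * ((a\<^sup>2 + c\<^sup>2) + (b\<^sup>2 + d\<^sup>2))" for a b c d :: real
      using zero_le_power2[of "a + b"] zero_le_power2[of "a + c"] zero_le_power2[of "a - d"]
        zero_le_power2[of "b - c"] zero_le_power2[of "b + d"] zero_le_power2[of "c + d"]
      by (simp add: power2_eq_square algebra_simps)
    show "(collision_kernel w (x, y) (x', y'))\<^sup>2
      \<le> 4 * ((?c x x' + ?c y x') + (?c x y' + ?c y y'))"
      unfolding collision_kernel_def prod.case
      by (rule order_trans[OF *]) (simp add: power_mult_distrib)
  qed
  also have "\<dots> = 4 * expect p (\<lambda>x. expect q (\<lambda>y.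
      (w x)\<^sup>2 * pmf p x + (w y)\<^sup>2 * pmf p y + ((w x)\<^sup>2 * pmf q x + (w y)\<^sup>2 * pmf q y)))"
    by (simp add: expect_add finp finq expect_of_bool_eq)
  also have "\<dots> = 4 * expect p (\<lambda>x. expect q (\<lambda>y.
      (w x)\<^sup>2 * (pmf p x + pmf q x) + (w y)\<^sup>2 * (pmf p y + pmf q y)))"
    by (simp add: algebra_simps)
  also have "\<dots> = 4 * (expect p (\<lambda>x. (w x)\<^sup>2 * (pmf p x + pmf q x))
      + expect q (\<lambda>y. (w y)\<^sup>2 * (pmf p y + pmf q y)))"
    by (simp only: expect_add finp finq) simp
  also have "\<dots> = 4 * (\<Sum>u\<in>\<Omega>. w u * (w u * (pmf p u + pmf q u)\<^sup>2))"
    unfolding expect_p expect_q sum.distrib[symmetric]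
    by (intro arg_cong[where f = "(*) 4"] sum.cong refl) (simp add: power2_eq_square algebra_simps)
  also have "\<dots> \<le> 4 * (\<Sum>u\<in>\<Omega>. 1 * (w u * (pmf p u + pmf q u)\<^sup>2))"
    by (intro mult_left_mono sum_mono mult_right_mono w1 mult_nonneg_nonneg w0) auto
  finally show ?thesis by (simp add: B_def)
qed

text \<open>Chebyshev's inequality for the bipartite statistic, fed with the two moment bounds for
  the kernel.\<close>

lemma collision_stat_deviation:
  fixes s :: nat
  defines "R \<equiv> replicate_pmf s (pair_pmf p q)"
  assumes "0 < c"
  shows "measure_pmf.prob (pair_pmf R R) {(zs, zs'). c \<le> \<bar>collision_stat w zs zs' - (real s)\<^sup>2 * D\<bar>}
    \<le> (4 * (real s)\<^sup>2 * B + 4 * real s ^ 3 * sqrt B * D) / c\<^sup>2"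
proof -
  have finR: "finite (set_pmf R)" by (simp add: R_def finp finq)
  let ?Z = "\<lambda>(zs, zs'). (collision_stat w zs zs' - (real s)\<^sup>2 * D)\<^sup>2"
  have "{(zs, zs'). c \<le> \<bar>collision_stat w zs zs' - (real s)\<^sup>2 * D\<bar>} = {z. c\<^sup>2 \<le> ?Z z}"
    using \<open>0 < c\<close> by (auto simp: abs_le_square_iff[symmetric])
  then have "measure_pmf.prob (pair_pmf R R) {(zs, zs'). c \<le> \<bar>collision_stat w zs zs' - (real s)\<^sup>2 * D\<bar>}
     \<le> expect (pair_pmf R R) ?Z / c\<^sup>2"
    using markov_pmf[of "pair_pmf R R" ?Z "c\<^sup>2"] finR assms by auto
  moreover have "expect (pair_pmf R R) ?Z \<le> 4 * (real s)\<^sup>2 * B + 4 * real s ^ 3 * sqrt B * D"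
  proof -
    have "expect (pair_pmf R R) ?Z
      \<le> (real s)\<^sup>2 * expect (pair_pmf p q) (\<lambda>x. expect (pair_pmf p q) (\<lambda>y. (collision_kernel w x y)\<^sup>2))
       + 2 * real s ^ 3 * expect (pair_pmf p q) (\<lambda>x. (expect (pair_pmf p q) (collision_kernel w x))\<^sup>2)"
      using bipartite_u_statistic[of "pair_pmf p q" "collision_kernel w" s,
          OF _ collision_kernel_sym]
      by (subst expect_pair[OF finR finR])
        (simp add: finp finq kernel_mean_mean R_def collision_stat_def)
    also have "\<dots> \<le> (real s)\<^sup>2 * (4 * B) + 2 * real s ^ 3 * (2 * sqrt B * D)"
      by (intro add_mono mult_left_mono kernel_second_moment kernel_mean_square) auto
    finally show ?thesis by simp
  qed
  ultimately show ?thesis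
    by (meson divide_right_mono order_trans zero_le_power2)
qed

end

section \<open>Flattening\<close>

text \<open>The count of \<open>u\<close> is binomial, and weighting a binomial variable by its
  value amounts to forcing one trial to succeed. \<open>f\<close> stays arbitrary since the
  induction also uses it shifted by one.\<close>

lemma expect_count_list_size_bias:
  assumes fin: "finite (set_pmf q)"
  shows "expect (replicate_pmf (Suc k) q) (\<lambda>fs. real (count_list fs u) * f (count_list fs u))
    = real (Suc k) * pmf q u * expect (replicate_pmf k q) (\<lambda>fs. f (Suc (count_list fs u)))"
proof (induction k arbitrary: f)
  case 0
  have "expect q (\<lambda>x. if x = u then f 1 else 0) = expect q (\<lambda>x. f 1 * of_bool (x = u))"
    by (rule expect_cong) auto
  then show ?case
    by (simp add: bind_return_pmf expect_bind fin expect_of_bool_eq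
        if_distrib[of "\<lambda>x. real x * _ x"] cong: if_cong)
next
  case (Suc k)
  let ?E = "\<lambda>k g. expect (replicate_pmf k q) (\<lambda>fs. g (count_list fs u))"
  \<comment> \<open>Condition on whether the first sample equals \<open>u\<close>.\<close>
  have step: "?E (Suc k) g = pmf q u * ?E k (\<lambda>a. g (Suc a)) + (1 - pmf q u) * ?E k g" for k g
  proof -
    have "?E (Suc k) g = expect q (\<lambda>x. ?E k g + (?E k (\<lambda>a. g (Suc a)) - ?E k g) * of_bool (x = u))"
      unfolding expect_replicate_Suc[OF fin] by (rule expect_cong) auto
    also have "\<dots> = ?E k g + (?E k (\<lambda>a. g (Suc a)) - ?E k g) * pmf q u"
      by (simp add: expect_add fin expect_of_bool_eq)
    finally show ?thesis by (simp only: algebra_simps)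
  qed
  have "?E (Suc (Suc k)) (\<lambda>a. real a * f a)
      = pmf q u * ?E (Suc k) (\<lambda>a. f (Suc a) + real a * f (Suc a))
        + (1 - pmf q u) * ?E (Suc k) (\<lambda>a. real a * f a)"
    by (subst step) (simp add: algebra_simps)
  also have "\<dots> = pmf q u * (?E (Suc k) (\<lambda>a. f (Suc a))
      + real (Suc k) * pmf q u * ?E k (\<lambda>a. f (Suc (Suc a))))
        + (1 - pmf q u) * (real (Suc k) * pmf q u * ?E k (\<lambda>a. f (Suc a)))"
    using Suc[of f] Suc[of "\<lambda>a. f (Suc a)"]
    by (simp only: expect_add[OF finite_set_replicate_pmf[OF fin]])
  also have "\<dots> = real (Suc (Suc k)) * pmf q u * ?E (Suc k) (\<lambda>a. f (Suc a))"
    unfolding step[of k "\<lambda>a. f (Suc a)"] by (simp add: algebra_simps)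
  finally show ?case .
qed

text \<open>Splitting \<open>u\<close> evenly into \<open>1 + a\<close> buckets divides its
  contribution to a squared L2 norm by \<open>1 + a\<close>. The weight has this effect without
  changing the domain.\<close>

definition flat_weight :: "'a list \<Rightarrow> 'a \<Rightarrow> real" where
  "flat_weight fs u = 1 / (1 + real (count_list fs u))"

text \<open>By size biasing with \<open>f a = 1 / a\<close>, the left-hand side is the probability
  that \<open>u\<close> occurs among \<open>k + 1\<close> samples.\<close>

lemma expect_flat_weight:
  assumes fin: "finite (set_pmf q)"
  shows "real (Suc k) * pmf q u * expect (replicate_pmf k q) (\<lambda>fs. flat_weight fs u) \<le> 1"
proof -
  have "real (Suc k) * pmf q u * expect (replicate_pmf k q) (\<lambda>fs. flat_weight fs u)
     = expect (replicate_pmf (Suc k) q) (\<lambda>fs. real (count_list fs u) * (1 / real (count_list fs u)))"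
    unfolding expect_count_list_size_bias[OF fin, of k u "\<lambda>a. 1 / real a"] by (simp add: flat_weight_def)
  \<comment> \<open>The integrand is an indicator: it is \<open>0\<close> for count \<open>0\<close>
    and \<open>1\<close> otherwise.\<close>
  also have "\<dots> \<le> expect (replicate_pmf (Suc k) q) (\<lambda>_. 1)"
    by (rule expect_mono) (use fin in \<open>auto simp del: replicate_pmf.simps\<close>)
  finally show ?thesis by simp
qed

text \<open>Each \<open>u\<close> adds at most \<open>q u / (k + 1)\<close> to the expected
  flattened norm, so the expectation is at most \<open>1 / (k + 1)\<close> and Markov's inequality
  applies.\<close>

lemma prob_flattened_norm:
  assumes fin: "finite \<Omega>" "set_pmf q \<subseteq> \<Omega>" and c: "0 < c"
  shows "measure_pmf.prob (replicate_pmf k q)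
    {fs. c / real (Suc k) \<le> (\<Sum>u\<in>\<Omega>. flat_weight fs u * (pmf q u)\<^sup>2)} \<le> 1 / c"
proof -
  have finq: "finite (set_pmf q)" using fin finite_subset by blast
  let ?F = "replicate_pmf k q"
  let ?b = "\<lambda>fs. \<Sum>u\<in>\<Omega>. flat_weight fs u * (pmf q u)\<^sup>2"
  have "real (Suc k) * expect ?F ?b
    = (\<Sum>u\<in>\<Omega>. pmf q u * (real (Suc k) * pmf q u * expect ?F (\<lambda>fs. flat_weight fs u)))"
    by (simp add: expect_sum finq sum_distrib_left power2_eq_square algebra_simps)
  also have "\<dots> \<le> (\<Sum>u\<in>\<Omega>. pmf q u * 1)"
    by (intro sum_mono mult_left_mono expect_flat_weight finq) auto
  also have "\<dots> = 1"
    using fin by (simp add: sum_pmf_eq_1)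
  finally have "expect ?F ?b \<le> 1 / real (Suc k)"
    by (simp add: field_simps)
  moreover have "measure_pmf.prob ?F {fs. c / real (Suc k) \<le> ?b fs} \<le> expect ?F ?b / (c / real (Suc k))"
    using c by (intro markov_pmf) (auto simp: finq flat_weight_def intro!: sum_nonneg)
  ultimately show ?thesis
    using c by (simp add: field_simps)
qed

text \<open>Cauchy-Schwarz with the factors \<open>1 / sqrt w\<close> and \<open>sqrt w\<close>. The
  sum of \<open>1 / w\<close> counts the buckets after flattening: one for each point of the support
  of \<open>q\<close> and at most one more for each flattening sample.\<close>

lemma flattened_l2_lower_bound:
  assumes fin: "finite (set_pmf q)" and n: "card (set_pmf q) \<le> n"
    and \<Omega>: "finite \<Omega>" "set_pmf q \<subseteq> \<Omega>"
  shows "(\<Sum>u\<in>set_pmf q. \<bar>pmf p u - pmf q u\<bar>)\<^sup>2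
    \<le> (real n + real (length fs)) * (\<Sum>u\<in>\<Omega>. flat_weight fs u * (pmf p u - pmf q u)\<^sup>2)"
proof -
  let ?w = "flat_weight fs" and ?S = "set_pmf q" and ?m = "\<lambda>u. \<bar>pmf p u - pmf q u\<bar>"
  have pos: "0 < ?w u" for u
    by (simp add: flat_weight_def add_pos_nonneg)
  have "(\<Sum>u\<in>?S. ?m u) = (\<Sum>u\<in>?S. (1 / sqrt (?w u)) * (sqrt (?w u) * ?m u))"
    using pos by (intro sum.cong) (auto simp: less_imp_neq[symmetric])
  then have "(\<Sum>u\<in>?S. ?m u)\<^sup>2
      \<le> (\<Sum>u\<in>?S. (1 / sqrt (?w u))\<^sup>2) * (\<Sum>u\<in>?S. (sqrt (?w u) * ?m u)\<^sup>2)"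
    using Cauchy_Schwarz_ineq_sum[of "\<lambda>u. 1 / sqrt (?w u)" "\<lambda>u. sqrt (?w u) * ?m u" ?S] by simp
  also have "\<dots> = (\<Sum>u\<in>?S. 1 / ?w u) * (\<Sum>u\<in>?S. ?w u * (pmf p u - pmf q u)\<^sup>2)"
    using pos by (simp add: power_divide power_mult_distrib less_imp_le)
  also have "\<dots> \<le> (real n + real (length fs)) * (\<Sum>u\<in>\<Omega>. ?w u * (pmf p u - pmf q u)\<^sup>2)"
  proof (rule mult_mono)
    have "(\<Sum>u\<in>?S. count_list fs u) \<le> (\<Sum>u\<in>?S \<union> set fs. count_list fs u)"
      by (rule sum_mono2) (auto simp: fin)
    also have "\<dots> = length fs"
      by (rule sum_count_set) (auto simp: fin)
    finally have "real (\<Sum>u\<in>?S. count_list fs u) \<le> real (length fs)"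
      by (rule of_nat_mono)
    moreover have "(\<Sum>u\<in>?S. 1 / ?w u) = real (card ?S) + real (\<Sum>u\<in>?S. count_list fs u)"
      by (simp add: flat_weight_def sum.distrib)
    ultimately show "(\<Sum>u\<in>?S. 1 / ?w u) \<le> real n + real (length fs)"
      using n by simp
    show "(\<Sum>u\<in>?S. ?w u * (pmf p u - pmf q u)\<^sup>2) \<le> (\<Sum>u\<in>\<Omega>. ?w u * (pmf p u - pmf q u)\<^sup>2)"
      by (intro sum_mono2 \<Omega> mult_nonneg_nonneg less_imp_le[OF pos]) auto
  qed (auto intro!: sum_nonneg mult_nonneg_nonneg less_imp_le[OF pos])
  finally show ?thesis .
qed

section \<open>Detecting a distance by collisions\<close>

context collision
begin

text \<open>
  Here \<open>d\<close> is the squared distance to be detected and \<open>N - 1\<close> the number of samples used for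
  flattening. The constants make the relative standard deviation of the statistic at most
  \<open>1/200\<close>, which suffices for Chebyshev.
\<close>

lemma collision_test_sound:
  fixes s :: nat and d N :: real
  defines "R \<equiv> replicate_pmf s (pair_pmf p q)"
  assumes d: "0 < d" "d \<le> D" and N: "0 < N" "N * d \<le> 1" and b: "b \<le> 12 / N"
    and s: "2000 / (sqrt N * d) \<le> real s"
  shows "measure_pmf.prob (pair_pmf R R) {(zs, zs'). collision_stat w zs zs' \<le> (real s)\<^sup>2 * d / 2} \<le> 1 / 12"
proof -
  have "0 < 2000 / (sqrt N * d)" using d N by simp
  then have s0: "0 < real s" using s by linarith
  have D0: "0 < D" using d by linarith
  define c where "c = (real s)\<^sup>2 * D / 2"
  have c0: "0 < c" using s0 D0 by (simp add: c_def)
  have s2: "4000000 / (N * d\<^sup>2) \<le> (real s)\<^sup>2"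
    using power_mono[OF s, of 2] d N by (simp add: power_divide power_mult_distrib)
  \<comment> \<open>\<open>r\<close> compares the noise with the mean; the Chebyshev bound will
    become \<open>16 * r^2 + 16 * r\<close>.\<close>
  define r where "r = sqrt B / (real s * D)"
  have r0: "0 \<le> r" using D0 B_nonneg by (simp add: r_def)
  have "B \<le> 96 / N + 2 * D" using B_le b by (simp add: field_simps)
  \<comment> \<open>Both summands are brought to the shape of the bound on \<open>s^2\<close>: the
    first by \<open>d \<le> D\<close>, the second by \<open>N * d \<le> 1\<close> in
    addition.\<close>
  also have "\<dots> \<le> 98 * D\<^sup>2 / (N * d\<^sup>2)"
  proof -
    have "96 / N \<le> 96 * D\<^sup>2 / (N * d\<^sup>2)"
      using d N power_mono[of d D 2] by (simp add: field_simps)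
    moreover have "2 * D \<le> 2 * D\<^sup>2 / (N * d\<^sup>2)"
    proof -
      have "N * d * d \<le> 1 * D" using d N by (intro mult_mono) auto
      then have "D * (N * d * d) \<le> D * D" using D0 by (intro mult_left_mono) auto
      then show ?thesis using d N by (simp add: field_simps power2_eq_square)
    qed
    ultimately show ?thesis by (simp add: add_divide_distrib[symmetric])
  qed
  finally have B: "B \<le> 98 * D\<^sup>2 / (N * d\<^sup>2)" .
  have "r\<^sup>2 = B / ((real s)\<^sup>2 * D\<^sup>2)"
    using B_nonneg by (simp add: r_def power_divide power_mult_distrib)
  also have "\<dots> \<le> (98 * D\<^sup>2 / (N * d\<^sup>2)) / ((4000000 / (N * d\<^sup>2)) * D\<^sup>2)"
    by (intro frac_le mult_right_mono s2 B) (use d N D0 in auto)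
  \<comment> \<open>98 / 4000000 is just below 1 / 40000.\<close>
  also have "\<dots> \<le> (1/200)\<^sup>2"
    using d N D0 by (simp add: field_simps)
  finally have r: "r \<le> 1/200"
    by (rule power2_le_imp_le) simp
  have "measure_pmf.prob (pair_pmf R R) {(zs, zs'). collision_stat w zs zs' \<le> (real s)\<^sup>2 * d / 2}
    \<le> measure_pmf.prob (pair_pmf R R) {(zs, zs'). c \<le> \<bar>collision_stat w zs zs' - (real s)\<^sup>2 * D\<bar>}"
  proof (rule measure_pmf.finite_measure_mono)
    \<comment> \<open>The threshold is at most half of the mean, so staying below it is a deviation
      by at least half of the mean.\<close>
    have "(real s)\<^sup>2 * d / 2 \<le> c"
      unfolding c_def using d by (simp add: mult_left_mono)
    moreover have "(real s)\<^sup>2 * D = 2 * c"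
      by (simp add: c_def)
    ultimately show "{(zs, zs'). collision_stat w zs zs' \<le> (real s)\<^sup>2 * d / 2}
      \<subseteq> {(zs, zs'). c \<le> \<bar>collision_stat w zs zs' - (real s)\<^sup>2 * D\<bar>}"
      by auto
  qed auto
  also have "\<dots> \<le> (4 * (real s)\<^sup>2 * B + 4 * real s ^ 3 * sqrt B * D) / c\<^sup>2"
    unfolding R_def by (rule collision_stat_deviation[OF c0])
  also have "\<dots> = 16 * r\<^sup>2 + 16 * r"
  proof -
    have "B = (r * (real s * D))\<^sup>2" "sqrt B = r * (real s * D)"
      using s0 D0 B_nonneg by (simp_all add: r_def)
    then show ?thesis
      using s0 D0 by (simp add: c_def field_simps power2_eq_square power3_eq_cube)
  qed
  also have "\<dots> \<le> 16 * (1/200)\<^sup>2 + 16 * (1/200)"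
    by (intro add_mono mult_left_mono power_mono r r0) auto
  also have "\<dots> \<le> 1 / 12"
    by (simp add: power2_eq_square)
  finally show ?thesis .
qed

text \<open>For \<open>p = q\<close> the mean \<open>D\<close> vanishes and with it the cubic term
  of the variance. The rest is a multiple of \<open>B\<close>, which is at most
  \<open>8 * b\<close>.\<close>

lemma collision_test_complete:
  fixes s :: nat and d N :: real
  defines "R \<equiv> replicate_pmf s (pair_pmf p q)"
  assumes eq: "p = q" and d: "0 < d" and N: "0 < N" and b: "b \<le> 12 / N"
    and s: "2000 / (sqrt N * d) \<le> real s"
  shows "measure_pmf.prob (pair_pmf R R) {(zs, zs'). (real s)\<^sup>2 * d / 2 < collision_stat w zs zs'} \<le> 1 / 12"
proof -
  have "0 < 2000 / (sqrt N * d)" using d N by simp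
  then have s0: "0 < real s" using s by linarith
  have D0: "D = 0" unfolding D_def by (simp add: eq)
  define c where "c = (real s)\<^sup>2 * d / 2"
  have c0: "0 < c" using s0 d by (simp add: c_def)
  have s2: "4000000 / (N * d\<^sup>2) \<le> (real s)\<^sup>2"
    using power_mono[OF s, of 2] d N by (simp add: power_divide power_mult_distrib)
  have B: "B \<le> 96 / N" using B_le b D0 by (simp add: field_simps)
  have "measure_pmf.prob (pair_pmf R R) {(zs, zs'). (real s)\<^sup>2 * d / 2 < collision_stat w zs zs'}
    \<le> measure_pmf.prob (pair_pmf R R) {(zs, zs'). c \<le> \<bar>collision_stat w zs zs' - (real s)\<^sup>2 * D\<bar>}"
    by (rule measure_pmf.finite_measure_mono) (auto simp: c_def D0)
  also have "\<dots> \<le> (4 * (real s)\<^sup>2 * B + 4 * real s ^ 3 * sqrt B * D) / c\<^sup>2"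
    unfolding R_def by (rule collision_stat_deviation[OF c0])
  also have "\<dots> = 16 * B / ((real s)\<^sup>2 * d\<^sup>2)"
    using s0 d by (simp add: D0 c_def field_simps power2_eq_square)
  also have "\<dots> \<le> 16 * (96 / N) / ((4000000 / (N * d\<^sup>2)) * d\<^sup>2)"
    by (intro frac_le mult_right_mono mult_left_mono s2 B) (use d N in auto)
  also have "\<dots> \<le> 1 / 12"
    using d N by (simp add: field_simps)
  finally show ?thesis .
qed

end

section \<open>Transport plans from a coupling of projections\<close>

lemma finite_cube [simp]: "finite (cube n)"
  unfolding cube_def using finite_lists_length_eq[of "UNIV :: bool set" n] by simp

lemma rel_hamming_nonneg: "0 \<le> rel_hamming n x y"
  by (simp add: rel_hamming_def)

lemma rel_hamming_le_1: "rel_hamming n x y \<le> 1"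
proof -
  have "card {i. i < n \<and> x ! i \<noteq> y ! i} \<le> card {..<n}"
    by (intro card_mono) auto
  then show ?thesis by (auto simp: rel_hamming_def divide_le_eq)
qed

lemma dist_distance_le:
  assumes "w \<in> transport_plans n P Q"
  shows "dist_distance n P Q \<le> (\<Sum>x\<in>cube n. \<Sum>y\<in>cube n. w x y * rel_hamming n x y)"
  unfolding dist_distance_def
  by (intro cINF_lower assms bdd_belowI2[of _ 0] sum_nonneg mult_nonneg_nonneg rel_hamming_nonneg)
    (auto simp: transport_plans_def)

lemma pmf_map_sum:
  assumes "finite A" "set_pmf p \<subseteq> A"
  shows "pmf (map_pmf f p) u = (\<Sum>x\<in>A. if f x = u then pmf p x else 0)"
proof -
  have "pmf (map_pmf f p) u = expect p (indicator {x. f x = u})"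
    by (simp add: pmf_map vimage_def)
  also have "\<dots> = (\<Sum>x\<in>A. pmf p x * indicator {x. f x = u} x)"
    by (rule expect_sum_superset[OF assms])
  also have "\<dots> = (\<Sum>x\<in>A. if f x = u then pmf p x else 0)"
    by (intro sum.cong) (auto simp: indicator_def)
  finally show ?thesis .
qed

text \<open>
  The transport plan moves as much mass as possible between strings with the same projection
  and couples the excess mass independently.
\<close>

lemma dist_distance_le_projected:
  assumes P: "set_pmf P \<subseteq> cube n" and Q: "set_pmf Q \<subseteq> cube n"
    and \<Omega>: "finite \<Omega>" "g ` cube n \<subseteq> \<Omega>" and \<eta>: "0 \<le> \<eta>"
  shows "dist_distance n P Q
    \<le> (1 - (\<Sum>u\<in>\<Omega>. min (pmf (map_pmf g P) u) (pmf (map_pmf g Q) u))) + \<eta>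
      + measure_pmf.prob P {x. \<exists>y\<in>set_pmf Q. g x = g y \<and> \<eta> < rel_hamming n x y}"
proof -
  let ?C = "cube n"
  define p q where "p = pmf (map_pmf g P)" and "q = pmf (map_pmf g Q)"
  define m where "m u = min (p u) (q u)" for u
  \<comment> \<open>The statistical distance of the two projections: the mass that cannot be
    matched.\<close>
  define t where "t = 1 - (\<Sum>u\<in>\<Omega>. m u)"
  \<comment> \<open>The excess mass at \<open>x\<close>. On a fibre of mass \<open>0\<close> the
    quotient is \<open>0\<close>, and so is \<open>pmf P x\<close>.\<close>
  define eP where "eP x = pmf P x * (1 - m (g x) / p (g x))" for x
  define eQ where "eQ y = pmf Q y * (1 - m (g y) / q (g y))" for y
  \<comment> \<open>In each fibre the matched mass \<open>m u\<close> is spread as the product of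
    the conditional distributions of \<open>P\<close> and \<open>Q\<close>.\<close>
  define w1 where "w1 x y = (if g x = g y then pmf P x * pmf Q y * (m (g x) / (p (g x) * q (g x))) else 0)" for x y
  define w where "w x y = w1 x y + eP x * eQ y / t" for x y
  define Bad where "Bad = {x. \<exists>y\<in>set_pmf Q. g x = g y \<and> \<eta> < rel_hamming n x y}"
  have p0: "0 \<le> p u" and q0: "0 \<le> q u" for u by (simp_all add: p_def q_def)
  then have m0: "0 \<le> m u" for u by (simp add: m_def)
  have mp: "m u / p u \<le> 1" and mq: "m u / q u \<le> 1" for u
    using p0[of u] q0[of u] by (auto simp: m_def divide_le_eq_1)
  have p_sum: "p u = (\<Sum>x\<in>?C. if g x = u then pmf P x else 0)" for u
    unfolding p_def by (rule pmf_map_sum) (use P in auto)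
  have q_sum: "q u = (\<Sum>x\<in>?C. if g x = u then pmf Q x else 0)" for u
    unfolding q_def by (rule pmf_map_sum) (use Q in auto)
  have sumP: "(\<Sum>x\<in>?C. pmf P x) = 1" and sumQ: "(\<Sum>x\<in>?C. pmf Q x) = 1"
    by (intro sum_pmf_eq_1 finite_cube P Q)+
  have fib: "(\<Sum>x\<in>?C. f x * h (g x)) = (\<Sum>u\<in>\<Omega>. (\<Sum>x\<in>?C. if g x = u then f x else 0) * h u)" for f h :: "_ \<Rightarrow> real"
  proof -
    have "(\<Sum>u\<in>\<Omega>. (\<Sum>x\<in>?C. if g x = u then f x else 0) * h u)
      = (\<Sum>x\<in>?C. \<Sum>u\<in>\<Omega>. if g x = u then f x * h u else 0)"
      unfolding sum_distrib_right by (subst sum.swap) (intro sum.cong refl; simp)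
    also have "\<dots> = (\<Sum>x\<in>?C. f x * h (g x))"
      using \<Omega> by (intro sum.cong refl) (auto simp: sum.delta)
    finally show ?thesis ..
  qed
  have pm: "p u * (m u / p u) = m u" "q u * (m u / q u) = m u" for u
    using p0[of u] q0[of u] by (auto simp: m_def)
  have seP: "(\<Sum>x\<in>?C. eP x) = t"
    unfolding eP_def right_diff_distrib sum_subtractf fib[of "pmf P" "\<lambda>u. m u / p u"]
      p_sum[symmetric] pm t_def by (simp add: sumP)
  have seQ: "(\<Sum>x\<in>?C. eQ x) = t"
    unfolding eQ_def right_diff_distrib sum_subtractf fib[of "pmf Q" "\<lambda>u. m u / q u"]
      q_sum[symmetric] pm t_def by (simp add: sumQ)
  have eP0: "0 \<le> eP x" and eQ0: "0 \<le> eQ x" for x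
    unfolding eP_def eQ_def using mp mq by (auto intro!: mult_nonneg_nonneg)
  have t0: "0 \<le> t" unfolding seP[symmetric] by (intro sum_nonneg eP0)
  \<comment> \<open>If \<open>t = 0\<close>, all excess vanishes as well, so dividing by
    \<open>t\<close> does no harm.\<close>
  have eP_t: "eP x * t / t = eP x" if "x \<in> ?C" for x
    using seP eP0 that by (auto simp: sum_nonneg_eq_0_iff)
  have eQ_t: "t * eQ x / t = eQ x" if "x \<in> ?C" for x
    using seQ eQ0 that by (auto simp: sum_nonneg_eq_0_iff)
  have w1_0: "0 \<le> w1 x y" for x y
    using p0 q0 m0 by (simp add: w1_def)
  have w0: "0 \<le> w x y" for x y
    unfolding w_def by (intro add_nonneg_nonneg w1_0 divide_nonneg_nonneg mult_nonneg_nonneg eP0 eQ0 t0)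
  have w1_row: "(\<Sum>y\<in>?C. w1 x y) = pmf P x * (m (g x) / p (g x))" for x
  proof -
    have "(\<Sum>y\<in>?C. w1 x y) = (\<Sum>y\<in>?C. (if g y = g x then pmf Q y else 0)
        * (pmf P x * (m (g x) / (p (g x) * q (g x)))))"
      by (intro sum.cong) (auto simp: w1_def)
    also have "\<dots> = q (g x) * (pmf P x * (m (g x) / (p (g x) * q (g x))))"
      unfolding sum_distrib_right[symmetric] q_sum[symmetric] ..
    also have "\<dots> = pmf P x * (m (g x) / p (g x))"
      using p0[of "g x"] q0[of "g x"] by (auto simp: m_def)
    finally show ?thesis .
  qed
  have w1_col: "(\<Sum>x\<in>?C. w1 x y) = pmf Q y * (m (g y) / q (g y))" for y
  proof -
    have "(\<Sum>x\<in>?C. w1 x y) = (\<Sum>x\<in>?C. (if g x = g y then pmf P x else 0)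
        * (pmf Q y * (m (g y) / (p (g y) * q (g y)))))"
      by (intro sum.cong) (auto simp: w1_def)
    also have "\<dots> = p (g y) * (pmf Q y * (m (g y) / (p (g y) * q (g y))))"
      unfolding sum_distrib_right[symmetric] p_sum[symmetric] ..
    also have "\<dots> = pmf Q y * (m (g y) / q (g y))"
      using p0[of "g y"] q0[of "g y"] by (auto simp: m_def)
    finally show ?thesis .
  qed
  have row: "(\<Sum>y\<in>?C. w x y) = pmf P x" if "x \<in> ?C" for x
    unfolding w_def sum.distrib w1_row
    by (simp add: sum_divide_distrib[symmetric] sum_distrib_left[symmetric] seQ eP_t[OF that])
      (simp add: eP_def algebra_simps)
  have col: "(\<Sum>x\<in>?C. w x y) = pmf Q y" if "y \<in> ?C" for y
    unfolding w_def sum.distrib w1_col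
    by (simp add: sum_divide_distrib[symmetric] sum_distrib_right[symmetric] seP eQ_t[OF that])
      (simp add: eQ_def algebra_simps)
  have "w \<in> transport_plans n P Q"
    using w0 row col by (simp add: transport_plans_def)
  then have "dist_distance n P Q \<le> (\<Sum>x\<in>?C. \<Sum>y\<in>?C. w x y * rel_hamming n x y)"
    by (rule dist_distance_le)
  \<comment> \<open>Moved excess costs at most 1 per unit of mass. Matched mass costs at most
    \<eta>, except that 1 more is charged when \<open>x\<close> lies in \<open>Bad\<close>.\<close>
  also have "\<dots> \<le> (\<Sum>x\<in>?C. \<Sum>y\<in>?C. eP x * eQ y / t + w1 x y * (\<eta> + indicator Bad x))"
  proof (intro sum_mono)
    fix x y
    have "w1 x y * rel_hamming n x y \<le> w1 x y * (\<eta> + indicator Bad x)"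
    proof (cases "w1 x y = 0")
      case False
      then have "g x = g y" "y \<in> set_pmf Q"
        by (auto simp: w1_def set_pmf_iff split: if_splits)
      then have "rel_hamming n x y \<le> \<eta> \<or> x \<in> Bad"
        by (auto simp: Bad_def not_le[symmetric])
      then have "rel_hamming n x y \<le> \<eta> + indicator Bad x"
        using rel_hamming_le_1[of n x y] \<eta> by (auto simp: indicator_def)
      then show ?thesis by (intro mult_left_mono w1_0)
    qed simp
    moreover have "eP x * eQ y / t * rel_hamming n x y \<le> eP x * eQ y / t * 1"
      by (intro mult_left_mono rel_hamming_le_1 divide_nonneg_nonneg mult_nonneg_nonneg eP0 eQ0 t0)
    ultimately show "w x y * rel_hamming n x y
        \<le> eP x * eQ y / t + w1 x y * (\<eta> + indicator Bad x)"
      by (simp add: w_def distrib_right)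
  qed
  also have "\<dots> = (\<Sum>x\<in>?C. eP x) + (\<Sum>x\<in>?C. pmf P x * (m (g x) / p (g x)) * (\<eta> + indicator Bad x))"
    unfolding sum.distrib sum_distrib_right[symmetric] w1_row
    by (simp add: sum_divide_distrib[symmetric] sum_distrib_left[symmetric] seQ eP_t)
  also have "\<dots> \<le> t + (\<Sum>x\<in>?C. pmf P x * 1 * (\<eta> + indicator Bad x))"
    unfolding seP using \<eta> mp
    by (intro add_mono order_refl sum_mono mult_right_mono mult_left_mono) auto
  also have "\<dots> = t + \<eta> + (\<Sum>x\<in>?C. pmf P x * indicator Bad x)"
    by (simp add: distrib_left sum.distrib sum_distrib_right[symmetric] sumP)
  also have "(\<Sum>x\<in>?C. pmf P x * indicator Bad x) = expect P (indicator Bad)"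
    by (rule expect_sum_superset[symmetric]) (use P in auto)
  finally show ?thesis
    by (simp add: t_def m_def p_def q_def Bad_def)
qed

section \<open>Projections to random positions\<close>

abbreviation proj :: "nat list \<Rightarrow> 'a list \<Rightarrow> 'a list" where
  "proj S x \<equiv> map ((!) x) S"

lemma expect_pmf_of_set_interval:
  assumes "1 \<le> n"
  shows "expect (pmf_of_set {0..<n}) (\<lambda>j. of_bool (Q j)) = real (card {j. j < n \<and> Q j}) / real n"
proof -
  have "expect (pmf_of_set {0..<n}) (\<lambda>j. of_bool (Q j)) = (\<Sum>j\<in>{0..<n}. of_bool (Q j)) / real n"
    using assms by (subst integral_pmf_of_set) auto
  also have "(\<Sum>j\<in>{0..<n}. of_bool (Q j)) = real (card ({0..<n} \<inter> {j. Q j}))"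
    by (simp add: of_bool_def sum.If_cases)
  also have "{0..<n} \<inter> {j. Q j} = {j. j < n \<and> Q j}"
    by auto
  finally show ?thesis .
qed

text \<open>The positions are independent, and the strings agree at each of them with probability
  \<open>1 - rel_hamming n x y\<close>.\<close>

lemma expect_projections_agree:
  assumes n: "1 \<le> n"
  shows "expect (replicate_pmf m (pmf_of_set {0..<n})) (\<lambda>S. of_bool (proj S x = proj S y))
    = (1 - rel_hamming n x y) ^ m"
proof (induction m)
  case 0
  then show ?case by simp
next
  case (Suc m)
  let ?U = "pmf_of_set {0..<n}"
  have fin: "finite (set_pmf ?U)" using n by simp
  have "{j. j < n \<and> x ! j = y ! j} = {..<n} - {j. j < n \<and> x ! j \<noteq> y ! j}"
    by auto
  then have "real (card {j. j < n \<and> x ! j = y ! j})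
      = real n - real (card {j. j < n \<and> x ! j \<noteq> y ! j})"
    by (simp add: card_Diff_subset of_nat_diff card_mono[of "{..<n}", simplified] subset_iff)
  then have *: "expect ?U (\<lambda>j. of_bool (x ! j = y ! j)) = 1 - rel_hamming n x y"
    using n by (simp add: expect_pmf_of_set_interval rel_hamming_def diff_divide_distrib)
  have "expect (replicate_pmf (Suc m) ?U) (\<lambda>S. of_bool (proj S x = proj S y))
    = expect ?U (\<lambda>j. of_bool (x ! j = y ! j)
        * expect (replicate_pmf m ?U) (\<lambda>S. of_bool (proj S x = proj S y)))"
    unfolding expect_replicate_Suc[OF fin] by (rule expect_cong) auto
  also have "\<dots> = (1 - rel_hamming n x y) * (1 - rel_hamming n x y) ^ m"
    by (simp only: integral_mult_left_zero * Suc)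
  finally show ?case by (simp only: power_Suc)
qed

text \<open>Exchange the expectations over \<open>S\<close> and \<open>x\<close> and take a union
  bound over \<open>Y\<close>: two fixed strings at distance above \<eta> agree at all
  \<open>m\<close> positions with probability at most \<open>(1 - \<eta>) ^ m\<close>.\<close>

lemma expect_false_match:
  assumes n: "1 \<le> n" and P: "finite (set_pmf P)" and Y: "finite Y" and \<eta>: "0 \<le> \<eta>" "\<eta> \<le> 1"
  shows "expect (replicate_pmf m (pmf_of_set {0..<n}))
      (\<lambda>S. measure_pmf.prob P {x. \<exists>y\<in>Y. proj S x = proj S y \<and> \<eta> < rel_hamming n x y})
    \<le> real (card Y) * (1 - \<eta>) ^ m"
proof -
  let ?U = "replicate_pmf m (pmf_of_set {0..<n})"
  have fin: "finite (set_pmf ?U)" using n by (intro finite_set_replicate_pmf) simp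
  let ?B = "\<lambda>S x y. of_bool (proj S x = proj S y) * of_bool (\<eta> < rel_hamming n x y) :: real"
  have "expect ?U (\<lambda>S. measure_pmf.prob P {x. \<exists>y\<in>Y. proj S x = proj S y \<and> \<eta> < rel_hamming n x y})
    \<le> expect ?U (\<lambda>S. expect P (\<lambda>x. \<Sum>y\<in>Y. ?B S x y))"
  proof (rule expect_mono[OF fin])
    fix S
    let ?A = "{x. \<exists>y\<in>Y. proj S x = proj S y \<and> \<eta> < rel_hamming n x y}"
    have "expect P (indicator ?A) \<le> expect P (\<lambda>x. \<Sum>y\<in>Y. ?B S x y)"
    proof (rule expect_mono[OF P])
      fix x
      show "indicator ?A x \<le> (\<Sum>y\<in>Y. ?B S x y)"
      proof (cases "x \<in> ?A")
        case True
        then obtain y where y: "y \<in> Y" "?B S x y = 1" by auto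
        then have "1 \<le> (\<Sum>y\<in>Y. ?B S x y)"
          using member_le_sum[of y Y "?B S x"] Y by simp
        then show ?thesis by (auto simp: indicator_def)
      qed (auto intro: sum_nonneg)
    qed
    then show "measure_pmf.prob P ?A \<le> expect P (\<lambda>x. \<Sum>y\<in>Y. ?B S x y)" by simp
  qed
  also have "\<dots> = expect P (\<lambda>x. \<Sum>y\<in>Y. (1 - rel_hamming n x y) ^ m * of_bool (\<eta> < rel_hamming n x y))"
    by (subst expect_swap[OF fin P])
      (simp add: expect_sum[OF fin] expect_projections_agree[OF n] del: map_eq_conv)
  also have "\<dots> \<le> expect P (\<lambda>x. \<Sum>y\<in>Y. (1 - \<eta>) ^ m)"
  proof (intro expect_mono P sum_mono)
    fix x y
    show "(1 - rel_hamming n x y) ^ m * of_bool (\<eta> < rel_hamming n x y) \<le> (1 - \<eta>) ^ m"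
      using \<eta> rel_hamming_le_1[of n x y] by (auto intro!: power_mono)
  qed
  finally show ?thesis by simp
qed

text \<open>The statistical distance is the total excess of \<open>q\<close> over \<open>p\<close>,
  which lives on the support of \<open>q\<close>. In the application that support has at most
  \<open>n\<close> points, however large the support of \<open>p\<close> is.\<close>

lemma one_minus_min_sum_le:
  assumes "finite \<Omega>" "set_pmf q \<subseteq> \<Omega>"
  shows "1 - (\<Sum>u\<in>\<Omega>. min (pmf p u) (pmf q u)) \<le> (\<Sum>u\<in>set_pmf q. \<bar>pmf p u - pmf q u\<bar>)"
proof -
  have "1 - (\<Sum>u\<in>\<Omega>. min (pmf p u) (pmf q u)) = (\<Sum>u\<in>\<Omega>. pmf q u - min (pmf p u) (pmf q u))"
    using assms by (simp add: sum_subtractf sum_pmf_eq_1)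
  also have "\<dots> = (\<Sum>u\<in>set_pmf q. pmf q u - min (pmf p u) (pmf q u))"
    using assms by (intro sum.mono_neutral_right) (auto simp: set_pmf_iff min_def)
  also have "\<dots> \<le> (\<Sum>u\<in>set_pmf q. \<bar>pmf p u - pmf q u\<bar>)"
    by (intro sum_mono) (auto simp: min_def)
  finally show ?thesis .
qed

section \<open>Cyclic shifts and their projections\<close>

lemma set_Ucyc_dist:
  assumes "x \<in> cube n" "1 \<le> n"
  shows "set_pmf (Ucyc_dist x) = (\<lambda>J. rotate J x) ` {0..<n}"
  using assms by (auto simp: Ucyc_dist_def cube_def)

lemma Ucyc_dist_cube:
  assumes "x \<in> cube n" "1 \<le> n"
  shows "set_pmf (Ucyc_dist x) \<subseteq> cube n" "finite (set_pmf (Ucyc_dist x))"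
    "card (set_pmf (Ucyc_dist x)) \<le> n"
  using assms card_image_le[of "{0..<n}" "\<lambda>J. rotate J x"]
  by (auto simp: set_Ucyc_dist cube_def)

text \<open>The uniform distribution on the residues modulo \<open>n\<close> is invariant under
  translation by \<open>i\<close>.\<close>

lemma Ucyc_dist_rotate:
  assumes "x \<in> cube n" "1 \<le> n"
  shows "Ucyc_dist (rotate i x) = Ucyc_dist x"
proof -
  have n: "length x = n" "n \<noteq> 0" using assms by (auto simp: cube_def)
  have inj: "inj_on (\<lambda>J. (J + i) mod n) {0..<n}"
  proof (rule inj_onI)
    fix a b assume "a \<in> {0..<n}" "b \<in> {0..<n}" "(a + i) mod n = (b + i) mod n"
    then show "a = b"
      by (cases a b rule: linorder_cases)
        (auto simp: mod_eq_dvd_iff_nat nat_dvd_not_less dest: sym[of "(a + i) mod n"])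
  qed
  have bij: "bij_betw (\<lambda>J. (J + i) mod n) {0..<n} {0..<n}"
    using n by (intro bij_betw_imageI[OF inj] endo_inj_surj inj) auto
  have "Ucyc_dist x = map_pmf (\<lambda>J. rotate J x) (map_pmf (\<lambda>J. (J + i) mod n) (pmf_of_set {0..<n}))"
    unfolding Ucyc_dist_def n using n by (subst map_pmf_of_set_bij_betw[OF bij]) auto
  also have "\<dots> = map_pmf (\<lambda>J. rotate J (rotate i x)) (pmf_of_set {0..<n})"
    unfolding map_pmf_comp rotate_rotate using rotate_conv_mod[of _ x] n
    by (intro map_pmf_cong refl) (metis)
  finally show ?thesis using n by (simp add: Ucyc_dist_def)
qed

text \<open>Every sample is a rotation of the defining string, so any one of them can serve as the
  reference string.\<close>

lemma Ucyc_dist_of_sample: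
  assumes "P \<in> Ucyc n" "x0 \<in> set_pmf P" "1 \<le> n"
  shows "Ucyc_dist x0 = P"
  using assms by (auto simp: Ucyc_def set_Ucyc_dist Ucyc_dist_rotate)

text \<open>The transport bound with \<eta> = \<epsilon>/2 shows that a projected distance below
  \<epsilon>/4 leaves at least \<epsilon>/4 for the mass of false matches. Their expected mass is
  small, so Markov's inequality makes this unlikely.\<close>

lemma projection_preserves_far:
  assumes n: "1 \<le> n" and \<epsilon>: "0 < \<epsilon>" "\<epsilon> < 1" and P: "set_pmf P \<subseteq> cube n"
    and x0: "x0 \<in> cube n" and far: "\<epsilon> < dist_distance n P (Ucyc_dist x0)"
    and m: "2 / \<epsilon> * ln (48 * real n / \<epsilon>) \<le> real m"
  shows "measure_pmf.prob (replicate_pmf m (pmf_of_set {0..<n}))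
    {S. (\<Sum>u\<in>set_pmf (map_pmf (proj S) (Ucyc_dist x0)).
          \<bar>pmf (map_pmf (proj S) P) u - pmf (map_pmf (proj S) (Ucyc_dist x0)) u\<bar>) < \<epsilon> / 4} \<le> 1 / 12"
    (is "measure_pmf.prob ?U ?A \<le> _")
proof -
  let ?Q = "Ucyc_dist x0"
  have finP: "finite (set_pmf P)" using P finite_subset finite_cube by blast
  let ?\<beta> = "\<lambda>S. measure_pmf.prob P {x. \<exists>y\<in>set_pmf ?Q. proj S x = proj S y \<and> \<epsilon> / 2 < rel_hamming n x y}"
  have "?A \<subseteq> {S. \<epsilon> / 4 \<le> ?\<beta> S}"
  proof safe
    fix S
    assume *: "(\<Sum>u\<in>set_pmf (map_pmf (proj S) ?Q).
          \<bar>pmf (map_pmf (proj S) P) u - pmf (map_pmf (proj S) ?Q) u\<bar>) < \<epsilon> / 4"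
    have "dist_distance n P ?Q \<le> (1 - (\<Sum>u\<in>proj S ` cube n.
        min (pmf (map_pmf (proj S) P) u) (pmf (map_pmf (proj S) ?Q) u))) + \<epsilon> / 2 + ?\<beta> S"
      using \<epsilon> Ucyc_dist_cube[OF x0 n] by (intro dist_distance_le_projected P) auto
    moreover have "1 - (\<Sum>u\<in>proj S ` cube n.
        min (pmf (map_pmf (proj S) P) u) (pmf (map_pmf (proj S) ?Q) u))
      \<le> (\<Sum>u\<in>set_pmf (map_pmf (proj S) ?Q).
          \<bar>pmf (map_pmf (proj S) P) u - pmf (map_pmf (proj S) ?Q) u\<bar>)"
      using Ucyc_dist_cube[OF x0 n] by (intro one_minus_min_sum_le) auto
    ultimately show "\<epsilon> / 4 \<le> ?\<beta> S" using * far by linarith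
  qed
  then have "measure_pmf.prob ?U ?A \<le> measure_pmf.prob ?U {S. \<epsilon> / 4 \<le> ?\<beta> S}"
    by (intro measure_pmf.finite_measure_mono) auto
  also have "\<dots> \<le> expect ?U ?\<beta> / (\<epsilon> / 4)"
    using n \<epsilon> by (intro markov_pmf finite_set_replicate_pmf) auto
  \<comment> \<open>The choice of \<open>m\<close> bounds a false match with a single shift by
    \<open>\<epsilon> / (48 * n)\<close>. With at most \<open>n\<close> shifts and Markov at
    \<epsilon>/4 this gives 4/48 = 1/12.\<close>
  also have "\<dots> \<le> (real n * (\<epsilon> / (48 * real n))) / (\<epsilon> / 4)"
  proof (intro divide_right_mono)
    have "expect ?U ?\<beta> \<le> real (card (set_pmf ?Q)) * (1 - \<epsilon> / 2) ^ m"
      using n \<epsilon> Ucyc_dist_cube[OF x0 n] by (intro expect_false_match finP) auto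
    also have "\<dots> \<le> real n * (\<epsilon> / (48 * real n))"
    proof (intro mult_mono)
      have "(1 - \<epsilon> / 2) ^ m \<le> exp (- (\<epsilon> / 2)) ^ m"
        using \<epsilon> exp_ge_add_one_self[of "- (\<epsilon> / 2)"] by (intro power_mono) auto
      also have "\<dots> = exp (- (\<epsilon> / 2 * real m))"
        by (simp add: exp_of_nat_mult[symmetric] mult.commute)
      also have "\<dots> \<le> exp (- ln (48 * real n / \<epsilon>))"
        using m \<epsilon> by (simp add: field_simps)
      also have "\<dots> = \<epsilon> / (48 * real n)"
        using n \<epsilon> by (simp add: exp_minus)
      finally show "(1 - \<epsilon> / 2) ^ m \<le> \<epsilon> / (48 * real n)" .
    qed (use n \<epsilon> Ucyc_dist_cube[OF x0 n] in auto)
    finally show "expect ?U ?\<beta> \<le> real n * (\<epsilon> / (48 * real n))" .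
  qed (use \<epsilon> in auto)
  also have "\<dots> = 1 / 12" using n \<epsilon> by simp
  finally show ?thesis .
qed

section \<open>Error analysis of the test with direct access to the distributions\<close>

lemma pmf_bind_le:
  assumes "finite (set_pmf p)" "measure_pmf.prob p Bad \<le> \<alpha>"
    "\<And>x. x \<in> set_pmf p \<Longrightarrow> x \<notin> Bad \<Longrightarrow> pmf (f x) c \<le> \<beta>" "0 \<le> \<beta>"
  shows "pmf (bind_pmf p f) c \<le> \<alpha> + \<beta>"
proof -
  have "pmf (bind_pmf p f) c = expect p (\<lambda>x. pmf (f x) c)"
    by (rule pmf_bind)
  also have "\<dots> \<le> expect p (\<lambda>x. indicator Bad x + \<beta>)"
  proof (rule expect_mono[OF assms(1)])
    fix x assume "x \<in> set_pmf p"
    then show "pmf (f x) c \<le> indicator Bad x + \<beta>"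
      using assms(3)[of x] assms(4) pmf_le_1[of "f x" c] by (cases "x \<in> Bad") auto
  qed
  also have "\<dots> = measure_pmf.prob p Bad + \<beta>"
    using assms by (simp add: expect_add)
  finally show ?thesis using assms(2) by linarith
qed

text \<open>The test for a given reference string \<open>x0\<close>, with projected samples drawn
  directly from their distributions. Its errors are bounded in this form; the decision trees are
  later shown to have the same outcome.\<close>

definition core_test :: "nat \<Rightarrow> nat \<Rightarrow> nat \<Rightarrow> nat \<Rightarrow> real \<Rightarrow> bool list pmf \<Rightarrow> bool list \<Rightarrow> bool pmf" where
  "core_test n m k s T P x0 = do {
     S \<leftarrow> replicate_pmf m (pmf_of_set {0..<n});
     let p = map_pmf (proj S) P; q = map_pmf (proj S) (Ucyc_dist x0);
         R = replicate_pmf s (pair_pmf p q) in do {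
     fs \<leftarrow> replicate_pmf k q;
     map_pmf (\<lambda>(zs, zs'). collision_stat (flat_weight fs) zs zs' \<le> T) (pair_pmf R R)}}"

text \<open>Equal distributions have equal projections, so the choice of positions contributes error
  \<open>0\<close>. The two others are a failed flattening and a deviation of the statistic.\<close>

lemma core_test_complete:
  assumes n: "1 \<le> n" and x0: "x0 \<in> cube n" and d: "0 < d"
    and s: "2000 / (sqrt (real (Suc k)) * d) \<le> real s"
  shows "pmf (core_test n m k s ((real s)\<^sup>2 * d / 2) (Ucyc_dist x0) x0) False \<le> 0 + (1 / 12 + 1 / 12)"
  unfolding core_test_def Let_def
proof (rule pmf_bind_le[where Bad = "{}"], goal_cases)
  case (3 S)
  let ?q = "map_pmf (proj S) (Ucyc_dist x0)"
  let ?\<Omega> = "set_pmf ?q"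
  have fin: "finite ?\<Omega>" using Ucyc_dist_cube[OF x0 n] by simp
  let ?Bad = "{fs. 12 / real (Suc k) \<le> (\<Sum>u\<in>?\<Omega>. flat_weight fs u * (pmf ?q u)\<^sup>2)}"
  show ?case
  proof (rule pmf_bind_le[where Bad = ?Bad], goal_cases)
    case 2
    show ?case by (rule prob_flattened_norm[OF fin order_refl]) simp
  next
    case (3 fs)
    interpret collision ?q ?q "flat_weight fs" ?\<Omega>
      by unfold_locales (use fin in \<open>auto simp: flat_weight_def\<close>)
    have "b \<le> 12 / real (Suc k)" unfolding b_def using 3 by simp
    from collision_test_complete[OF refl d _ this s]
    show ?case by (simp add: pmf_map vimage_def not_le case_prod_unfold)
  qed (use fin in auto)
qed (use n in auto)

text \<open>Three events cost 1/12 each: the projection loses too much distance, the flattening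
  fails, or the statistic deviates. \<open>d\<close> is what Cauchy-Schwarz retains of a projected
  distance \<epsilon>/4.\<close>

lemma core_test_sound:
  assumes n: "1 \<le> n" and \<epsilon>: "0 < \<epsilon>" "\<epsilon> < 1" and P: "set_pmf P \<subseteq> cube n"
    and x0: "x0 \<in> cube n" and far: "\<epsilon> < dist_distance n P (Ucyc_dist x0)"
    and m: "2 / \<epsilon> * ln (48 * real n / \<epsilon>) \<le> real m"
    and d: "d = (\<epsilon> / 4)\<^sup>2 / (real n + real k)"
    and s: "2000 / (sqrt (real (Suc k)) * d) \<le> real s"
  shows "pmf (core_test n m k s ((real s)\<^sup>2 * d / 2) P x0) True \<le> 1 / 12 + (1 / 12 + 1 / 12)"
  unfolding core_test_def Let_def
proof (rule pmf_bind_le[where Bad = "{S. (\<Sum>u\<in>set_pmf (map_pmf (proj S) (Ucyc_dist x0)).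
    \<bar>pmf (map_pmf (proj S) P) u - pmf (map_pmf (proj S) (Ucyc_dist x0)) u\<bar>) < \<epsilon> / 4}"], goal_cases)
  case 2
  show ?case by (rule projection_preserves_far[OF n \<epsilon> P x0 far m])
next
  case (3 S)
  let ?p = "map_pmf (proj S) P" and ?q = "map_pmf (proj S) (Ucyc_dist x0)"
  let ?\<Omega> = "proj S ` cube n"
  have fin: "finite ?\<Omega>" by simp
  have sub: "set_pmf ?p \<subseteq> ?\<Omega>" "set_pmf ?q \<subseteq> ?\<Omega>"
    using P Ucyc_dist_cube[OF x0 n] by auto
  have finq: "finite (set_pmf ?q)" using Ucyc_dist_cube[OF x0 n] by simp
  have cardq: "card (set_pmf ?q) \<le> n"
    using Ucyc_dist_cube[OF x0 n] card_image_le[of "set_pmf (Ucyc_dist x0)" "proj S"]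
    by simp
  let ?Bad = "{fs. 12 / real (Suc k) \<le> (\<Sum>u\<in>?\<Omega>. flat_weight fs u * (pmf ?q u)\<^sup>2)}"
  show ?case
  proof (rule pmf_bind_le[where Bad = ?Bad], goal_cases)
    case 2
    show ?case by (rule prob_flattened_norm[OF fin sub(2)]) simp
  next
    case (3 fs)
    interpret collision ?p ?q "flat_weight fs" ?\<Omega>
      by unfold_locales (use sub in \<open>auto simp: flat_weight_def\<close>)
    have len: "length fs = k" using 3 by (simp add: set_replicate_pmf)
    have "(\<epsilon> / 4)\<^sup>2 \<le> (\<Sum>u\<in>set_pmf ?q. \<bar>pmf ?p u - pmf ?q u\<bar>)\<^sup>2"
      using \<open>S \<notin> _\<close> \<epsilon> by (intro power_mono) auto
    also have "\<dots> \<le> (real n + real k) * D"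
      unfolding D_def len[symmetric] by (rule flattened_l2_lower_bound[OF finq cardq fin sub(2)])
    finally have dD: "d \<le> D" using n by (simp add: d field_simps)
    have d0: "0 < d" using n \<epsilon> by (simp add: d)
    \<comment> \<open>Here \<open>n \<ge> 1\<close> gives \<open>Suc k \<le> n + k\<close>.\<close>
    have "real (Suc k) * d \<le> 1"
    proof -
      have "(\<epsilon> / 4)\<^sup>2 \<le> 1" using \<epsilon> by (intro power_le_one) auto
      moreover have "real (Suc k) \<le> real n + real k" using n by simp
      ultimately have "real (Suc k) * (\<epsilon> / 4)\<^sup>2 \<le> (real n + real k) * 1"
        by (intro mult_mono) auto
      then show ?thesis using n by (simp add: d field_simps)
    qed
    moreover have "b \<le> 12 / real (Suc k)" unfolding b_def using 3 by simp
    ultimately show ?case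
      using collision_test_sound[OF d0 dD _ _ _ s]
      by (simp add: pmf_map vimage_def case_prod_unfold)
  qed (use finq in auto)
qed (use n in auto)

section \<open>The tester as a distribution over decision trees\<close>

text \<open>A non-adaptive algorithm as a tree: all listed bits are queried in turn,
  \<open>M\<close> collects the answers, and \<open>g\<close> judges the final table.\<close>

primrec read_all :: "(nat \<times> nat) list \<Rightarrow> ((nat \<times> nat \<Rightarrow> bool) \<Rightarrow> bool) \<Rightarrow> (nat \<times> nat \<Rightarrow> bool) \<Rightarrow> dtree" where
  "read_all [] g M = Verdict (g M)"
| "read_all (z # zs) g M =
     Query (fst z) (snd z) (read_all zs g (M(z := False))) (read_all zs g (M(z := True)))"

lemma run_read_all:
  "run (read_all zs g M) X = g (\<lambda>z. if z \<in> set zs then X (fst z) ! snd z else M z)"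
proof (induction zs arbitrary: M)
  case (Cons z zs)
  then show ?case by (auto intro!: arg_cong[where f = g])
qed simp

lemma num_queries_read_all: "num_queries (read_all zs g M) = length zs"
  by (induction zs arbitrary: M) auto

lemma well_formed_read_all:
  "well_formed s n (read_all zs g M) \<longleftrightarrow> (\<forall>(i, j)\<in>set zs. i < s \<and> j < n)"
  by (induction zs arbitrary: M) auto

text \<open>Bridge between the oracle, a product over sample indices, and lists of independent
  samples. The induction splits off the last index, whose sample is appended at the end.\<close>

lemma map_Pi_pmf_upt:
  "map_pmf (\<lambda>X. map X [0..<N]) (Pi_pmf {..<N} d (\<lambda>_. P)) = replicate_pmf N P"
proof (induction N)
  case 0
  then show ?case by simp
next
  case (Suc N)
  have "map_pmf (\<lambda>X. map X [0..<Suc N]) (Pi_pmf {..<Suc N} d (\<lambda>_. P))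
    = bind_pmf P (\<lambda>y. bind_pmf (Pi_pmf {..<N} d (\<lambda>_. P)) (\<lambda>X. return_pmf (map X [0..<N] @ [y])))"
    unfolding lessThan_Suc by (subst Pi_pmf_insert')
      (auto simp: map_pmf_def bind_assoc_pmf bind_return_pmf intro!: bind_pmf_cong)
  also have "\<dots> = bind_pmf (Pi_pmf {..<N} d (\<lambda>_. P)) (\<lambda>X. bind_pmf P (\<lambda>y. return_pmf (map X [0..<N] @ [y])))"
    by (rule bind_commute_pmf)
  also have "\<dots> = bind_pmf (map_pmf (\<lambda>X. map X [0..<N]) (Pi_pmf {..<N} d (\<lambda>_. P)))
      (\<lambda>xs. bind_pmf P (\<lambda>y. return_pmf (xs @ [y])))"
    by (simp add: bind_map_pmf)
  also have "\<dots> = replicate_pmf (N + 1) P"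
    unfolding Suc replicate_pmf_distrib by (simp add: bind_assoc_pmf bind_return_pmf)
  finally show ?case by simp
qed

text \<open>
  Below, samples are lookup functions \<open>nat \<Rightarrow> bool\<close> rather than lists, since only their queried
  bits are known; \<open>shift_proj n S (nth x0) J\<close> is \<open>proj S (rotate J x0)\<close>.
\<close>

definition shift_proj :: "nat \<Rightarrow> nat list \<Rightarrow> (nat \<Rightarrow> bool) \<Rightarrow> nat \<Rightarrow> bool list" where
  "shift_proj n S x0 J = map (\<lambda>j. x0 ((J + j) mod n)) S"

text \<open>\<open>F\<close> holds the shifts of the flattening samples; \<open>J1\<close> and
  \<open>J2\<close> hold those of the simulated reference samples in the two batches.\<close>

definition decide :: "nat \<Rightarrow> real \<Rightarrow> nat list \<Rightarrow> nat list \<Rightarrow> nat list \<Rightarrow> nat list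
    \<Rightarrow> (nat \<Rightarrow> bool) \<Rightarrow> (nat \<Rightarrow> bool) list \<Rightarrow> (nat \<Rightarrow> bool) list \<Rightarrow> bool" where
  "decide n T S F J1 J2 x0 xs ys \<longleftrightarrow>
     collision_stat (flat_weight (map (shift_proj n S x0) F))
       (zip (map (\<lambda>x. map x S) xs) (map (shift_proj n S x0) J1))
       (zip (map (\<lambda>x. map x S) ys) (map (shift_proj n S x0) J2)) \<le> T"

text \<open>Sample \<open>0\<close> is the reference string, read at shifted positions to simulate
  its rotations. Samples \<open>1\<close> to \<open>2 * s\<close> are fresh samples for the two
  batches.\<close>

definition query_list :: "nat \<Rightarrow> nat \<Rightarrow> nat list \<Rightarrow> nat list \<Rightarrow> nat list \<Rightarrow> nat list \<Rightarrow> (nat \<times> nat) list" where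
  "query_list n s S F J1 J2 =
     map (\<lambda>(J, j). (0, (J + j) mod n)) (List.product (F @ J1 @ J2) S)
     @ List.product [1..<Suc (2 * s)] S"

definition tester_tree :: "nat \<Rightarrow> nat \<Rightarrow> real \<Rightarrow> nat list \<Rightarrow> nat list \<Rightarrow> nat list \<Rightarrow> nat list \<Rightarrow> dtree" where
  "tester_tree n s T S F J1 J2 = read_all (query_list n s S F J1 J2)
     (\<lambda>M. decide n T S F J1 J2 (curry M 0) (map (curry M) [1..<Suc s])
        (map (curry M) [Suc s..<Suc (s + s)])) (\<lambda>_. False)"

definition coin_trees :: "nat \<Rightarrow> nat \<Rightarrow> nat \<Rightarrow> nat \<Rightarrow> real \<Rightarrow> dtree pmf" where
  "coin_trees n m k s T = do {
     S \<leftarrow> replicate_pmf m (pmf_of_set {0..<n});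
     F \<leftarrow> replicate_pmf k (pmf_of_set {0..<n});
     J1 \<leftarrow> replicate_pmf s (pmf_of_set {0..<n});
     J2 \<leftarrow> replicate_pmf s (pmf_of_set {0..<n});
     return_pmf (tester_tree n s T S F J1 J2)}"

text \<open>\<open>decide\<close> looks only at entries on the query list, so the default
  \<open>False\<close> of the table never matters.\<close>

lemma run_tester_tree:
  "run (tester_tree n s T S F J1 J2) X
    = decide n T S F J1 J2 (nth (X 0)) (map (\<lambda>i. nth (X i)) [1..<Suc s])
        (map (\<lambda>i. nth (X i)) [Suc s..<Suc (s + s)])"
proof -
  define M where "M z \<longleftrightarrow> (if z \<in> set (query_list n s S F J1 J2) then X (fst z) ! snd z else False)" for z
  have ref: "map (shift_proj n S (curry M 0)) L = map (shift_proj n S (nth (X 0))) L"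
    if "set L \<subseteq> set (F @ J1 @ J2)" for L
    using that by (force simp: M_def query_list_def shift_proj_def)
  have sam: "map (\<lambda>x. map x S) (map (curry M) is) = map (\<lambda>x. map x S) (map (\<lambda>i. nth (X i)) is)"
    if "set is \<subseteq> {1..<Suc (2 * s)}" for "is"
    using that by (auto simp: M_def query_list_def)
  have "run (tester_tree n s T S F J1 J2) X
    = decide n T S F J1 J2 (curry M 0) (map (curry M) [1..<Suc s]) (map (curry M) [Suc s..<Suc (s + s)])"
    unfolding tester_tree_def run_read_all M_def by simp
  also have "\<dots> = decide n T S F J1 J2 (nth (X 0)) (map (\<lambda>i. nth (X i)) [1..<Suc s])
        (map (\<lambda>i. nth (X i)) [Suc s..<Suc (s + s)])"
    unfolding decide_def by (subst (1 2 3) ref; (subst (1 2) sam)?) auto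
  finally show ?thesis .
qed

text \<open>A projected reference sample is a function of a uniform shift. All shifts are coins and
  can be drawn before the samples of \<open>P\<close>.\<close>

lemma core_test_unfold:
  assumes n: "1 \<le> n" and x0: "x0 \<in> cube n"
  shows "core_test n m k s T P x0 = do {
     S \<leftarrow> replicate_pmf m (pmf_of_set {0..<n});
     F \<leftarrow> replicate_pmf k (pmf_of_set {0..<n});
     J1 \<leftarrow> replicate_pmf s (pmf_of_set {0..<n});
     J2 \<leftarrow> replicate_pmf s (pmf_of_set {0..<n});
     xs \<leftarrow> replicate_pmf s P;
     ys \<leftarrow> replicate_pmf s P;
     return_pmf (decide n T S F J1 J2 (nth x0) (map nth xs) (map nth ys))}"
  unfolding core_test_def Let_def
proof (intro bind_pmf_cong refl)
  fix S assume S: "S \<in> set_pmf (replicate_pmf m (pmf_of_set {0..<n}))"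
  let ?U = "pmf_of_set {0..<n}"
  let ?y = "shift_proj n S (nth x0)"
  have "set S \<subseteq> {0..<n}" using S n by (auto simp: set_replicate_pmf in_lists_conv_set)
  then have "proj S (rotate J x0) = ?y J" for J
    using x0 by (auto simp: shift_proj_def cube_def nth_rotate)
  then have q: "map_pmf (proj S) (Ucyc_dist x0) = map_pmf ?y ?U"
    using x0 by (simp add: Ucyc_dist_def map_pmf_comp cube_def)
  show "replicate_pmf k (map_pmf (proj S) (Ucyc_dist x0)) \<bind>
      (\<lambda>fs. map_pmf (\<lambda>(zs, zs'). collision_stat (flat_weight fs) zs zs' \<le> T)
        (pair_pmf (replicate_pmf s (pair_pmf (map_pmf (proj S) P) (map_pmf (proj S) (Ucyc_dist x0))))
          (replicate_pmf s (pair_pmf (map_pmf (proj S) P) (map_pmf (proj S) (Ucyc_dist x0))))))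
    = replicate_pmf k ?U \<bind> (\<lambda>F. replicate_pmf s ?U \<bind> (\<lambda>J1. replicate_pmf s ?U \<bind> (\<lambda>J2.
      replicate_pmf s P \<bind> (\<lambda>xs. replicate_pmf s P \<bind> (\<lambda>ys.
        return_pmf (decide n T S F J1 J2 (nth x0) (map nth xs) (map nth ys)))))))"
    unfolding q replicate_pmf_pair unfolding replicate_pmf_map pair_pmf_def
    by (simp add: map_pmf_def bind_assoc_pmf bind_return_pmf decide_def comp_def
        bind_commute_pmf[of "replicate_pmf s P" "replicate_pmf s ?U"])
qed

text \<open>Coins and samples are independent, so drawing the reference string may be moved ahead of
  the coins.\<close>

lemma outcome_coin_trees:
  assumes n: "1 \<le> n" and P: "set_pmf P \<subseteq> cube n"
  shows "outcome (Suc (s + s), coin_trees n m k s T) P = bind_pmf P (core_test n m k s T P)"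
proof -
  let ?U = "pmf_of_set {0..<n}"
  have tree: "map_pmf (run (tester_tree n s T S F J1 J2)) (Pi_pmf {..<Suc (s + s)} [] (\<lambda>_. P))
    = P \<bind> (\<lambda>x0. replicate_pmf s P \<bind> (\<lambda>xs. replicate_pmf s P \<bind> (\<lambda>ys.
        return_pmf (decide n T S F J1 J2 (nth x0) (map nth xs) (map nth ys)))))" for S F J1 J2
  proof -
    let ?D = "\<lambda>xs. decide n T S F J1 J2 (nth (hd xs)) (map nth (take s (tl xs))) (map nth (drop s (tl xs)))"
    have split: "[0..<Suc (s + s)] = 0 # [1..<Suc s] @ [Suc s..<Suc (s + s)]"
      using upt_add_eq_append[of 1 "Suc s" s] by (simp add: upt_conv_Cons[of 0] del: upt_Suc)
    have "run (tester_tree n s T S F J1 J2) = ?D \<circ> (\<lambda>X. map X [0..<Suc (s + s)])"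
      by (rule ext) (simp add: run_tester_tree split comp_def del: upt_Suc)
    then have "map_pmf (run (tester_tree n s T S F J1 J2)) (Pi_pmf {..<Suc (s + s)} [] (\<lambda>_. P))
      = map_pmf ?D (replicate_pmf (Suc (s + s)) P)"
      unfolding map_Pi_pmf_upt[of "Suc (s + s)" "[]" P, symmetric] map_pmf_comp comp_def
      by (rule arg_cong)
    also have "\<dots> = P \<bind> (\<lambda>x0. replicate_pmf s P \<bind> (\<lambda>xs. replicate_pmf s P \<bind> (\<lambda>ys.
        return_pmf (decide n T S F J1 J2 (nth x0) (map nth xs) (map nth ys)))))"
      unfolding replicate_pmf.simps replicate_pmf_distrib map_pmf_def bind_assoc_pmf bind_return_pmf
      by (intro bind_pmf_cong refl) (auto simp: set_replicate_pmf)
    finally show ?thesis .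
  qed
  have "bind_pmf P (core_test n m k s T P) = P \<bind> (\<lambda>x0.
     replicate_pmf m ?U \<bind> (\<lambda>S. replicate_pmf k ?U \<bind> (\<lambda>F.
     replicate_pmf s ?U \<bind> (\<lambda>J1. replicate_pmf s ?U \<bind> (\<lambda>J2.
     replicate_pmf s P \<bind> (\<lambda>xs. replicate_pmf s P \<bind> (\<lambda>ys.
     return_pmf (decide n T S F J1 J2 (nth x0) (map nth xs) (map nth ys)))))))))"
    using P by (intro bind_pmf_cong refl core_test_unfold n) auto
  also have "\<dots> = outcome (Suc (s + s), coin_trees n m k s T) P"
    unfolding outcome_def coin_trees_def fst_conv snd_conv bind_assoc_pmf bind_return_pmf tree
    by (simp only: bind_commute_pmf[of P "replicate_pmf _ ?U"])
  finally show ?thesis ..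
qed

text \<open>There are \<open>k + 2 * s\<close> simulated and \<open>2 * s\<close> fresh samples,
  each read at \<open>m\<close> positions.\<close>

lemma coin_trees_queries:
  assumes n: "1 \<le> n" and t: "t \<in> set_pmf (coin_trees n m k s T)"
  shows "well_formed (Suc (s + s)) n t" "num_queries t = (k + 4 * s) * m"
proof -
  obtain S F J1 J2 where *: "t = tester_tree n s T S F J1 J2" "set S \<subseteq> {0..<n}"
    "length S = m" "length F = k" "length J1 = s" "length J2 = s"
  proof -
    from t n obtain S F J1 J2 where "t = tester_tree n s T S F J1 J2"
      "S \<in> set_pmf (replicate_pmf m (pmf_of_set {0..<n}))"
      "F \<in> set_pmf (replicate_pmf k (pmf_of_set {0..<n}))"
      "J1 \<in> set_pmf (replicate_pmf s (pmf_of_set {0..<n}))"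
      "J2 \<in> set_pmf (replicate_pmf s (pmf_of_set {0..<n}))"
      unfolding coin_trees_def set_bind_pmf set_return_pmf by blast
    with n that[of S F J1 J2] show thesis
      by (simp add: set_replicate_pmf lists_eq_set)
  qed
  then show "well_formed (Suc (s + s)) n t"
    using n by (auto simp: tester_tree_def well_formed_read_all query_list_def)
  show "num_queries t = (k + 4 * s) * m"
    using * by (simp add: tester_tree_def num_queries_read_all query_list_def algebra_simps)
qed

text \<open>Project everything to a single point and take \<eta> = 1: the projections coincide and
  no pair is bad.\<close>

lemma dist_distance_le_1:
  assumes "set_pmf P \<subseteq> cube n" "set_pmf Q \<subseteq> cube n"
  shows "dist_distance n P Q \<le> 1"
proof -
  have "\<not> 1 < rel_hamming n x y" for x y
    using rel_hamming_le_1[of n x y] by linarith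
  moreover have "(\<lambda>_. ()) ` cube n \<subseteq> {()}" by auto
  ultimately show ?thesis
    using dist_distance_le_projected[OF assms, of "{()}" "\<lambda>_. ()" 1] by (simp add: map_pmf_const)
qed

section \<open>Parameters and query complexity\<close>

text \<open>Balances the number \<open>k\<close> of flattening samples against the batch size, which
  is of order \<open>n / sqrt k\<close> for fixed \<epsilon>.\<close>

definition flat_samples :: "nat \<Rightarrow> nat" where
  "flat_samples n = nat \<lceil>real n powr (2/3)\<rceil>"

text \<open>64000 = 2000 * 16 * 2: the constant of the Chebyshev bounds, the square in
  \<open>(\<epsilon> / 4)\<^sup>2\<close>, and \<open>n + k \<le> 2 * n\<close>.\<close>

definition batch_size :: "nat \<Rightarrow> real \<Rightarrow> nat" where
  "batch_size n \<epsilon> = nat \<lceil>64000 * real n powr (2/3) / \<epsilon>\<^sup>2\<rceil>"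

definition num_positions :: "nat \<Rightarrow> real \<Rightarrow> nat" where
  "num_positions n \<epsilon> = nat \<lceil>2 / \<epsilon> * ln (48 * real n / \<epsilon>)\<rceil>"

definition sq_distance :: "nat \<Rightarrow> real \<Rightarrow> real" where
  "sq_distance n \<epsilon> = (\<epsilon> / 4)\<^sup>2 / (real n + real (flat_samples n))"

definition query_bound :: "nat \<Rightarrow> real \<Rightarrow> nat" where
  "query_bound n \<epsilon> =
     (if \<epsilon> < 1 then (flat_samples n + 4 * batch_size n \<epsilon>) * num_positions n \<epsilon> else 0)"

text \<open>For \<epsilon> \<ge> 1 nothing is \<epsilon>-far, as distances to members are at most 1,
  so accepting without a query is correct.\<close>

definition Ucyc_tester :: "nat \<Rightarrow> real \<Rightarrow> algorithm" where
  "Ucyc_tester n \<epsilon> =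
     (if \<epsilon> < 1 then (Suc (batch_size n \<epsilon> + batch_size n \<epsilon>),
        coin_trees n (num_positions n \<epsilon>) (flat_samples n) (batch_size n \<epsilon>)
          ((real (batch_size n \<epsilon>))\<^sup>2 * sq_distance n \<epsilon> / 2))
      else (0, return_pmf (Verdict True)))"

lemma sq_distance_pos: "1 \<le> n \<Longrightarrow> 0 < \<epsilon> \<Longrightarrow> 0 < sq_distance n \<epsilon>"
  by (simp add: sq_distance_def)

lemma flat_samples_bounds:
  assumes "1 \<le> n"
  shows "real n powr (2/3) \<le> real (flat_samples n)" "flat_samples n \<le> n"
    "real (flat_samples n) \<le> real n powr (2/3) + 1"
proof -
  show "real n powr (2/3) \<le> real (flat_samples n)"
    unfolding flat_samples_def by linarith
  have "real n powr (2/3) \<le> real n powr 1"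
    using assms by (intro powr_mono) auto
  then show "flat_samples n \<le> n"
    unfolding flat_samples_def using assms by (simp add: ceiling_le_iff nat_le_iff)
  show "real (flat_samples n) \<le> real n powr (2/3) + 1"
    unfolding flat_samples_def using powr_ge_zero[of "real n" "2/3"] by linarith
qed

text \<open>With \<open>k = flat_samples n\<close>, \<open>k \<le> n\<close> bounds the numerator
  and \<open>sqrt (k + 1) \<ge> n powr (1/3)\<close> the denominator, which leaves the power 2/3 of
  \<open>n\<close>.\<close>

lemma batch_size_large:
  assumes n: "1 \<le> n" and \<epsilon>: "0 < \<epsilon>"
  shows "2000 / (sqrt (real (Suc (flat_samples n))) * sq_distance n \<epsilon>) \<le> real (batch_size n \<epsilon>)"
proof -
  have "2000 / (sqrt (real (Suc (flat_samples n))) * sq_distance n \<epsilon>)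
    = 32000 * (real n + real (flat_samples n)) / (sqrt (real (Suc (flat_samples n))) * \<epsilon>\<^sup>2)"
    by (simp add: sq_distance_def field_simps power_divide)
  also have "\<dots> \<le> 32000 * (2 * real n) / (real n powr (1/3) * \<epsilon>\<^sup>2)"
  proof (intro frac_le mult_left_mono mult_right_mono)
    have "real n powr (1/3) = sqrt (real n powr (2/3))"
      by (simp add: powr_half_sqrt[symmetric] powr_powr)
    also have "\<dots> \<le> sqrt (real (Suc (flat_samples n)))"
      using flat_samples_bounds(1)[OF n] by simp
    finally show "real n powr (1/3) \<le> sqrt (real (Suc (flat_samples n)))" .
  qed (use n \<epsilon> flat_samples_bounds(2)[OF n] in auto)
  also have "\<dots> = 64000 * real n powr (2/3) / \<epsilon>\<^sup>2"
  proof -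
    have "real n = real n powr (2/3) * real n powr (1/3)"
      using n by (simp add: powr_add[symmetric])
    then show ?thesis
      using n \<epsilon> by (simp add: field_simps)
  qed
  also have "\<dots> \<le> real (batch_size n \<epsilon>)"
    unfolding batch_size_def by linarith
  finally show ?thesis .
qed

lemma Ucyc_tester_correct:
  assumes n: "1 \<le> n" and \<epsilon>: "0 < \<epsilon>"
  shows "is_tester Ucyc n \<epsilon> (Ucyc_tester n \<epsilon>)"
    "query_complexity_le (Ucyc_tester n \<epsilon>) (query_bound n \<epsilon>)"
proof -
  show "query_complexity_le (Ucyc_tester n \<epsilon>) (query_bound n \<epsilon>)"
    using n by (auto simp: query_complexity_le_def Ucyc_tester_def query_bound_def coin_trees_queries)
  show "is_tester Ucyc n \<epsilon> (Ucyc_tester n \<epsilon>)"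
  proof (cases "\<epsilon> < 1")
    case False
    have "\<not> far_from n \<epsilon> P (Ucyc n)" if P: "set_pmf P \<subseteq> cube n" for P
    proof -
      obtain x where x: "x \<in> set_pmf P" using set_pmf_not_empty[of P] by blast
      then have "dist_distance n P (Ucyc_dist x) \<le> 1"
        using P n Ucyc_dist_cube by (intro dist_distance_le_1) auto
      moreover have "Ucyc_dist x \<in> Ucyc n" using x P by (auto simp: Ucyc_def)
      ultimately show ?thesis using False by (force simp: far_from_def)
    qed
    then show ?thesis
      using False by (simp add: is_tester_def Ucyc_tester_def outcome_def bind_return_pmf)
  next
    case True
    define m k s d where "m = num_positions n \<epsilon>" and "k = flat_samples n"
      and "s = batch_size n \<epsilon>" and "d = sq_distance n \<epsilon>"
    define T where "T = (real s)\<^sup>2 * d / 2"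
    have A: "Ucyc_tester n \<epsilon> = (Suc (s + s), coin_trees n m k s T)"
      using True by (simp add: Ucyc_tester_def m_def k_def s_def d_def T_def)
    have s: "2000 / (sqrt (real (Suc k)) * d) \<le> real s"
      unfolding k_def d_def s_def by (rule batch_size_large[OF n \<epsilon>])
    have m: "2 / \<epsilon> * ln (48 * real n / \<epsilon>) \<le> real m"
      unfolding m_def num_positions_def by linarith
    have d0: "0 < d" unfolding d_def by (rule sq_distance_pos[OF n \<epsilon>])
    have d: "d = (\<epsilon> / 4)\<^sup>2 / (real n + real k)" by (simp add: d_def k_def sq_distance_def)
    have acc: "2/3 \<le> pmf (outcome (Ucyc_tester n \<epsilon>) P) True"
      if P: "set_pmf P \<subseteq> cube n" "P \<in> Ucyc n" for P
    proof -
      \<comment> \<open>Every sample is a good reference string here; the total error is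
        1/6.\<close>
      have "pmf (bind_pmf P (core_test n m k s T P)) False \<le> 0 + (0 + (1/12 + 1/12))"
      proof (rule pmf_bind_le[where Bad = "{}"])
        fix x0 assume "x0 \<in> set_pmf P"
        then show "pmf (core_test n m k s T P x0) False \<le> 0 + (1/12 + 1/12)"
          using core_test_complete[OF n _ d0 s, of x0 m] P Ucyc_dist_of_sample[OF P(2) _ n, of x0]
          unfolding T_def by auto
      qed (use finite_subset[OF P(1)] in auto)
      then show ?thesis
        unfolding A outcome_coin_trees[OF n P(1)] by (simp add: pmf_False_conv_True)
    qed
    have rej: "2/3 \<le> pmf (outcome (Ucyc_tester n \<epsilon>) P) False"
      if P: "set_pmf P \<subseteq> cube n" "far_from n \<epsilon> P (Ucyc n)" for P
    proof -
      \<comment> \<open>Being far from the property means being far from the distribution of every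
        possible reference string; the total error is 1/4.\<close>
      have "pmf (bind_pmf P (core_test n m k s T P)) True \<le> 0 + (1/12 + (1/12 + 1/12))"
      proof (rule pmf_bind_le[where Bad = "{}"])
        fix x0 assume "x0 \<in> set_pmf P"
        then have "x0 \<in> cube n" "\<epsilon> < dist_distance n P (Ucyc_dist x0)"
          using P by (auto simp: far_from_def Ucyc_def)
        from core_test_sound[OF n \<epsilon> True P(1) this m d s]
        show "pmf (core_test n m k s T P x0) True \<le> 1/12 + (1/12 + 1/12)"
          unfolding T_def .
      qed (use finite_subset[OF P(1)] in auto)
      then show ?thesis
        unfolding A outcome_coin_trees[OF n P(1)] by (simp add: pmf_False_conv_True)
    qed
    show ?thesis
      unfolding is_tester_def using acc rej coin_trees_queries(1)[OF n] by (auto simp: A)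
  qed
qed

text \<open>The logarithm of \<open>48 * n / \<epsilon>\<close> has to be absorbed into one of
  \<open>2 + f\<close>. This works because \<open>n\<close> and \<open>1 / \<epsilon>\<close> are
  both polynomially bounded in \<open>f\<close> for \<epsilon> < 1.\<close>

lemma soft_O_query_bound: "soft_O query_bound (\<lambda>n \<epsilon>. real n powr (2/3) / \<epsilon> ^ 3)"
  unfolding soft_O_def
proof (intro exI allI impI, elim conjE)
  fix n :: nat and \<epsilon> :: real
  assume n: "1 \<le> n" and \<epsilon>: "0 < \<epsilon>"
  define L f where "L = real n powr (2/3)" and "f = real n powr (2/3) / \<epsilon> ^ 3"
  have L1: "1 \<le> L" unfolding L_def using n by (intro ge_one_powr_ge_zero) auto
  have f0: "0 \<le> f" using \<epsilon> by (simp add: f_def)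
  show "real (query_bound n \<epsilon>) \<le> 5376126 * f * ln (2 + f) ^ 1"
  proof (cases "\<epsilon> < 1")
    case False
    then show ?thesis using f0 by (simp add: query_bound_def)
  next
    case True
    have e1: "1 \<le> 1 / \<epsilon> ^ i" for i using \<epsilon> True by (simp add: power_le_one)
    have fL: "f = L * (1 / \<epsilon> ^ 3)" by (simp add: f_def L_def)
    have Lf: "L \<le> f" unfolding fL using mult_left_mono[OF e1[of 3], of L] L1 by simp
    have ef: "1 / \<epsilon> \<le> f"
    proof -
      have "1 * (1 / \<epsilon>) \<le> L * (1 / \<epsilon> ^ 3)"
        using \<epsilon> True L1 power_decreasing[of 1 3 \<epsilon>] by (intro mult_mono) (auto simp: frac_le)
      then show ?thesis by (simp add: fL)
    qed
    have nL: "real n \<le> L\<^sup>2"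
    proof -
      have "real n powr 1 \<le> real n powr (4/3)" using n by (intro powr_mono) auto
      also have "\<dots> = L\<^sup>2" by (simp add: L_def power2_eq_square powr_add[symmetric])
      finally show ?thesis using n by simp
    qed
    let ?l = "ln (48 * real n / \<epsilon>)"
    have "48 * real n / \<epsilon> = 48 * real n * (1 / \<epsilon>)" by simp
    \<comment> \<open>The three factors bound \<open>48 \<le> 3 ^ 4\<close>,
      \<open>n \<le> L^2\<close> and \<open>1 / \<epsilon> \<le> f\<close>, using
      \<open>1 \<le> L \<le> f\<close>.\<close>
    also have "\<dots> \<le> (2 + f) ^ 4 * (2 + f)\<^sup>2 * (2 + f)"
    proof (intro mult_mono)
      have "(3::real) ^ 4 \<le> (2 + f) ^ 4" using L1 Lf by (intro power_mono) auto
      then show "48 \<le> (2 + f) ^ 4" by simp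
      have "L\<^sup>2 \<le> (2 + f)\<^sup>2" using L1 Lf by (intro power_mono) auto
      then show "real n \<le> (2 + f)\<^sup>2" using nL by linarith
    qed (use f0 ef \<epsilon> in auto)
    also have "\<dots> = (2 + f) ^ 7"
      by (simp add: power_add[symmetric] power_Suc2[symmetric] del: power_Suc)
    finally have "?l \<le> ln ((2 + f) ^ 7)" using n \<epsilon> f0 by (subst ln_le_cancel_iff) auto
    then have l7: "?l \<le> 7 * ln (2 + f)" using f0 by (simp add: ln_realpow)
    \<comment> \<open>This lets the \<open>+ 1\<close> from rounding up the number of positions be
      absorbed, turning the factor 2 into 3.\<close>
    have l1: "1 \<le> ?l"
    proof -
      have "exp 1 \<le> (3::real)" by (rule exp_le)
      also have "\<dots> \<le> 48 * real n * (1 / \<epsilon>)"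
        using n e1[of 1] mult_mono[of 3 "48 * real n" 1 "1 / \<epsilon>"] by simp
      finally show ?thesis using n \<epsilon> by (simp add: ln_ge_iff)
    qed
    have k: "real (flat_samples n) \<le> 2 * (L * (1 / \<epsilon>\<^sup>2))"
      using flat_samples_bounds(3)[OF n] L1 mult_left_mono[OF e1[of 2], of L] by (simp add: L_def)
    have s: "real (batch_size n \<epsilon>) \<le> 64001 * (L * (1 / \<epsilon>\<^sup>2))"
    proof -
      have "0 \<le> 64000 * L / \<epsilon>\<^sup>2" using L1 by simp
      then have "real (batch_size n \<epsilon>) \<le> 64000 * L / \<epsilon>\<^sup>2 + 1"
        unfolding batch_size_def L_def by linarith
      then show ?thesis using L1 mult_mono[OF L1 e1[of 2]] by simp
    qed
    have m: "real (num_positions n \<epsilon>) \<le> 3 * (1 / \<epsilon>) * ?l"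
    proof -
      have "0 \<le> 2 / \<epsilon> * ?l" using \<epsilon> l1 by simp
      then have "real (num_positions n \<epsilon>) \<le> 2 / \<epsilon> * ?l + 1"
        unfolding num_positions_def by linarith
      moreover have "1 \<le> (1 / \<epsilon>) * ?l" using mult_mono[OF e1[of 1] l1] \<epsilon> by simp
      ultimately show ?thesis by (simp add: algebra_simps)
    qed
    have "real (query_bound n \<epsilon>)
      = (real (flat_samples n) + 4 * real (batch_size n \<epsilon>)) * real (num_positions n \<epsilon>)"
      using True by (simp add: query_bound_def)
    \<comment> \<open>256006 = 2 + 4 * 64001, and the final constant is 256006 * 3 * 7.\<close>
    also have "\<dots> \<le> (256006 * (L * (1 / \<epsilon>\<^sup>2))) * (3 * (1 / \<epsilon>) * (7 * ln (2 + f)))"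
    proof (rule mult_mono)
      show "real (flat_samples n) + 4 * real (batch_size n \<epsilon>) \<le> 256006 * (L * (1 / \<epsilon>\<^sup>2))"
        using k s by linarith
      have "3 * (1 / \<epsilon>) * ?l \<le> 3 * (1 / \<epsilon>) * (7 * ln (2 + f))"
        using \<epsilon> l7 by (intro mult_left_mono) auto
      then show "real (num_positions n \<epsilon>) \<le> 3 * (1 / \<epsilon>) * (7 * ln (2 + f))"
        using m by linarith
    qed (use L1 in auto)
    also have "\<dots> = 5376126 * f * ln (2 + f) ^ 1"
      by (simp add: fL power2_eq_square power3_eq_cube)
    finally show ?thesis .
  qed
qed

theorem theorem4p4:
  "\<exists>q :: nat \<Rightarrow> real \<Rightarrow> nat.
     soft_O q (\<lambda>n \<epsilon>. real n powr (2/3) / \<epsilon> ^ 3) \<and> DoHO_testable Ucyc q"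
  using soft_O_query_bound Ucyc_tester_correct unfolding DoHO_testable_def by blast

end
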